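(* Consider the distributed weighted sampling algorithm described in the context, run with parameters $k\ge 1$ (number of sites) and $s\ge 1$ (sample size) on an arbitrary stream $(e_1,w_1),\dots,(e_n,w_n)$ with all $w_i\ge 1$. The assignment of items to sites and the arrival order are arbitrary but fixed in advance, independent of the algorithm's randomness. Let $W=\sum_{i=1}^n w_i$. Then: (i) For every time $t\in[n]$, the set of identifiers returned by the coordinator's query procedure after the $t$-th item has been processed is a weighted random sample without replacement of size $\min\{t,s\}$ from $\{(e_1,w_1),\dots,(e_t,w_t)\}$. (ii) There is an absolute constant $C>0$ such that the expected total number of messages sent, counting both directions, satisfies $$\mathbb{E}[\#\text{messages}]\le C\cdot k\cdot\frac{1+\log(1+W/s)}{\log(1+k/s)}.$$ The paper states this bound as $O\!\left(k\frac{\log(W/s)}{\log(1+k/s)}\right)$.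
   Context: **Weighted sampling without replacement.** A single weighted random sample from a finite collection of items $(e,w)$ with positive weights is one item, where item $(e,w)$ is chosen with probability $w/\sum_{(e',w')}w'$. Occurrences of the same identifier are treated as distinct items. A weighted random sample without replacement (weighted SWOR) of size $m$ from a collection $\mathcal S$ is produced as follows: start with $S=\emptyset$; for $i=1,\dots,m$, draw a single weighted random sample from $\mathcal S\setminus S$ and add it to $S$. **Model.** There are $k$ sites and one coordinator. Stream items $(e_i,w_i)$ arrive one at a time in the global order $i=1,\dots,n$. Each item arrives at one site. Sites and the coordinator exchange messages, each consisting of $O(1)$ words. Every item is fully processed, including all messages it triggers, before the next item arrives. **Algorithm.** Let $r=\max\{2,k/s\}$. The level of a weight $w\ge 1$ is the unique integer $j\ge 0$ with $w\in[r^j,r^{j+1})$. All exponential random variables are rate $1$ and independent of everything else. Every site keeps a flag $\mathrm{sat}_j$ for each level $j$, initially false, and a threshold $\tau$, initially $0$. The coordinator keeps, for each level $j$, a set $D_j$ (initially empty) and a flag $\mathrm{sat}_j$ (initially false). It also keeps a set $S$ of at most $s$ triples $(e,w,v)$, initially empty. Let $u$ denote the smallest key in $S$ if $|S|=s$, and $u=0$ otherwise. *Inserting* $(e,w,v)$ into $S$ means: add it to $S$; if now $|S|>s$, remove the triple with the smallest key. After any change to $S$, if $u\ge 1$ and the integer $j=\lfloor\log_r u\rfloor$ differs from its value after the previous change (or $u$ was previously $<1$), the coordinator sends $r^j$ to all $k$ sites, and each site sets $\tau\leftarrow r^j$. *Site behaviour.* When a site receives $(e,w)$ of level $j$: - If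 $\mathrm{sat}_j$ is false, it sends $(e,w)$ to the coordinator (an early message). - Otherwise it draws an exponential $t$, sets $v=w/t$, and sends $(e,w,v)$ to the coordinator if and only if $v>\tau$ (a regular message). *Coordinator behaviour.* - On an early message $(e,w)$ of level $j$: it draws an exponential $t$ and adds $(e,w,w/t)$ to $D_j$. If then $|D_j|\ge 4rs$, it inserts every triple of $D_j$ into $S$, sets $D_j=\emptyset$ and $\mathrm{sat}_j=$ true, and sends a message to all $k$ sites, which set their $\mathrm{sat}_j$ to true. - On a regular message $(e,w,v)$: if $v>u$, it inserts $(e,w,v)$ into $S$. *Query.* The coordinator returns the identifiers of the $\min\{t,s\}$ triples with the largest keys in $S\cup\bigcup_j D_j$. *)

theory Defs
  imports "HOL-Probability.Probability"
begin

text \<open>Items are identified with their stream positions (indices), so that repeated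
identifiers are distinct items.  A single weighted random sample from a finite set B of
indices with weights w.\<close>

definition weighted_pick :: "(nat \<Rightarrow> real) \<Rightarrow> nat set \<Rightarrow> nat pmf" where
  "weighted_pick w B = embed_pmf (\<lambda>i. if i \<in> B then w i / (\<Sum>j\<in>B. w j) else 0)"

fun swor :: "(nat \<Rightarrow> real) \<Rightarrow> nat set \<Rightarrow> nat \<Rightarrow> nat set pmf" where
  "swor w A 0 = return_pmf {}"
| "swor w A (Suc m) =
     bind_pmf (swor w A m) (\<lambda>S.
       if A - S = {} then return_pmf S
       else map_pmf (\<lambda>i. insert i S) (weighted_pick w (A - S)))"

text \<open>Exactly one rate-1 exponential is drawn per stream item (by the coordinator for an
early message, by the site otherwise); we let T i be that exponential for item i, so the
key of item i is w i / T i.\<close>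

definition rpar :: "nat \<Rightarrow> nat \<Rightarrow> real" where
  "rpar k s = max 2 (real k / real s)"

definition level :: "real \<Rightarrow> real \<Rightarrow> nat" where
  "level r x = nat \<lfloor>log r x\<rfloor>"

record astate =
  site_sat :: "nat \<Rightarrow> nat \<Rightarrow> bool"   \<comment> \<open>site, level\<close>
  site_tau :: "nat \<Rightarrow> real"
  coordD   :: "nat \<Rightarrow> nat set"
  coord_sat :: "nat \<Rightarrow> bool"
  coordS   :: "nat set"                 \<comment> \<open>S (indices; key = w/T)\<close>
  last_lvl :: "int option"             \<comment> \<open>Some j if u \<ge> 1 after the last change of S, else None\<close>
  msgs     :: nat

definition init_state :: astate where
  "init_state = \<lparr>site_sat = (\<lambda>_ _. False), site_tau = (\<lambda>_. 0), coordD = (\<lambda>_. {}),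
     coord_sat = (\<lambda>_. False), coordS = {}, last_lvl = None, msgs = 0\<rparr>"

definition ukey :: "nat \<Rightarrow> (nat \<Rightarrow> real) \<Rightarrow> nat set \<Rightarrow> real" where
  "ukey s v S = (if card S = s then Min (v ` S) else 0)"

text \<open>Triple with smallest key (ties, a null event, broken by index).\<close>
definition min_key_elem :: "(nat \<Rightarrow> real) \<Rightarrow> nat set \<Rightarrow> nat" where
  "min_key_elem v S = hd (sort_key v (sorted_list_of_set S))"

definition raw_insert :: "nat \<Rightarrow> (nat \<Rightarrow> real) \<Rightarrow> nat \<Rightarrow> nat set \<Rightarrow> nat set" where
  "raw_insert s v i S = (let S' = insert i S in
      if card S' > s then S' - {min_key_elem v S'} else S')"

definition ins_S :: "nat \<Rightarrow> nat \<Rightarrow> (nat \<Rightarrow> real) \<Rightarrow> nat \<Rightarrow> astate \<Rightarrow> astate" where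
  "ins_S k s v i st = (let S' = raw_insert s v i (coordS st); u = ukey s v S'; r = rpar k s in
     if u \<ge> 1 then
       (let j = \<lfloor>log r u\<rfloor> in
        if last_lvl st \<noteq> Some j then
          st\<lparr>coordS := S', last_lvl := Some j, site_tau := (\<lambda>_. r powr of_int j),
             msgs := msgs st + k\<rparr>
        else st\<lparr>coordS := S'\<rparr>)
     else st\<lparr>coordS := S', last_lvl := None\<rparr>)"

definition step :: "nat \<Rightarrow> nat \<Rightarrow> (nat \<Rightarrow> real) \<Rightarrow> (nat \<Rightarrow> nat) \<Rightarrow> (nat \<Rightarrow> real)
                     \<Rightarrow> astate \<Rightarrow> nat \<Rightarrow> astate" where
  "step k s w site T st i = (let r = rpar k s; j = level r (w i); q = site i;
       v = (\<lambda>m. w m / T m) in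
     if \<not> site_sat st q j then
       (let st1 = st\<lparr>msgs := msgs st + 1, coordD := (coordD st)(j := insert i (coordD st j))\<rparr> in
        if real (card (coordD st1 j)) \<ge> 4 * r * real s then
          (let st2 = fold (ins_S k s v) (sorted_list_of_set (coordD st1 j)) st1 in
           st2\<lparr>coordD := (coordD st2)(j := {}), coord_sat := (coord_sat st2)(j := True),
               site_sat := (\<lambda>q' j'. if j' = j then True else site_sat st2 q' j'),
               msgs := msgs st2 + k\<rparr>)
        else st1)
     else if v i > site_tau st q then
       (let st1 = st\<lparr>msgs := msgs st + 1\<rparr> in
        if v i > ukey s v (coordS st1) then ins_S k s v i st1 else st1)
     else st)"

definition run :: "nat \<Rightarrow> nat \<Rightarrow> (nat \<Rightarrow> real) \<Rightarrow> (nat \<Rightarrow> nat) \<Rightarrow> (nat \<Rightarrow> real)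
                    \<Rightarrow> nat \<Rightarrow> astate" where
  "run k s w site T t = foldl (step k s w site T) init_state [0..<t]"

definition top_keys :: "nat \<Rightarrow> (nat \<Rightarrow> real) \<Rightarrow> nat set \<Rightarrow> nat set" where
  "top_keys m v P = set (take m (sort_key (\<lambda>i. - v i) (sorted_list_of_set P)))"

definition query :: "nat \<Rightarrow> (nat \<Rightarrow> real) \<Rightarrow> (nat \<Rightarrow> real) \<Rightarrow> nat \<Rightarrow> astate \<Rightarrow> nat set" where
  "query s w T t st = top_keys (min t s) (\<lambda>m. w m / T m) (coordS st \<union> \<Union> (range (coordD st)))"

definition expM :: "nat \<Rightarrow> (nat \<Rightarrow> real) measure" where
  "expM n = PiM {..<n} (\<lambda>_. density lborel (exponential_density 1))"

end

theory Submission
  imports Defs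
begin

text \<open>The weights determine when a level saturates, so the set of items that have left the level
  buffers at time \<open>t\<close> is deterministic, and \<open>S\<close> always holds the \<open>s\<close> largest keys of that set.
  Hence \<open>S\<close> and the buffers together contain the top keys of the whole prefix.

  The item with key \<open>w i / T i\<close> arrives at time \<open>T i / w i\<close> in a race of exponential clocks with
  rates \<open>w i\<close>. Integrating out all clocks but those in \<open>S\<close>, the event that \<open>S\<close> arrives first and
  is followed by \<open>i\<close> has the probability that \<open>S\<close> arrives first times the share of \<open>w i\<close> in the
  remaining weight; this is the recursion for sampling without replacement.

  For the messages, let \<open>V\<close> be the released weight when a regular item \<open>i\<close> arrives. Saturation
  forces \<open>4 * s * w i \<le> V\<close>, and likewise for every released item, so by Chernoff's bound the \<open>s\<close>-th
  largest key falls below \<open>x\<close> with probability at most \<open>16 / (1 + V / (4 * s * x))^2\<close>. Summed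
  against \<open>w i\<close> this telescopes to \<open>O (s * x)\<close>. An item sent while the threshold is \<open>r ^ j\<close>
  has a key above \<open>r ^ j\<close>, which happens with probability at most \<open>w i / r ^ j\<close>, while the \<open>s\<close>-th
  largest key is below \<open>r ^ (j + 1)\<close>; so each threshold costs \<open>O (r * s)\<close> messages in expectation,
  and about \<open>log r (W / s)\<close> thresholds matter.\<close>

section \<open>Invariants of a run\<close>

text \<open>The analysis is pathwise: for every positive \<open>T\<close> an invariant bounds the
  messages by deterministic counts, the number of regular items sent, and \<open>k\<close> times the
  number of powers \<open>r ^ j\<close> up to the smallest key \<open>u\<close> of \<open>S\<close>.
  The last term is a potential: once positive, \<open>u\<close> never decreases, so each threshold
  broadcast uses up a fresh power. Expectations are taken only afterwards, and only of indicators of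
  keys; the law of the state is never described.

  Ties obstruct the sampling law only. The invariant compares keys weakly and so tolerates them; the
  race discards them as a null event.

  The threshold met by item \<open>i\<close> depends on earlier clocks alone, so the two
  probabilities in the cost of a regular item multiply.

  Chernoff's bound is weakened to inverse-square decay because the sum over items is then a Riemann
  sum with an elementary antiderivative.

  Streams with \<open>W < s * r\<close> need a separate argument. The general estimate contains an
  additive multiple of \<open>k\<close>, which is too large for the target when \<open>k / s\<close>
  is large and \<open>W / s\<close> stays bounded. Such streams saturate no level, so they cost at
  most \<open>n \<le> W\<close> messages.\<close>

lemma min_key_elem:
  assumes "finite S" "S \<noteq> {}"
  shows "min_key_elem v S \<in> S" "\<And>a. a \<in> S \<Longrightarrow> v (min_key_elem v S) \<le> v a"
proof -
  let ?xs = "sort_key v (sorted_list_of_set S)"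
  have set: "set ?xs = S" using assms by simp
  then obtain y ys where xs: "?xs = y # ys" using assms by (cases ?xs) auto
  have m: "min_key_elem v S = y" by (simp add: min_key_elem_def xs)
  show "min_key_elem v S \<in> S" using set xs m by auto
  have "sorted (map v ?xs)" by simp
  then have "\<forall>z\<in>set ys. v y \<le> v z" by (simp add: xs)
  then show "\<And>a. a \<in> S \<Longrightarrow> v (min_key_elem v S) \<le> v a" using set xs m by auto
qed

text \<open>The comparison is weak, so with ties several sets qualify. This keeps the invariant of a
  run valid for all positive exponentials, not just for almost all.\<close>

definition top_set :: "nat \<Rightarrow> (nat \<Rightarrow> real) \<Rightarrow> nat set \<Rightarrow> nat set \<Rightarrow> bool" where
  "top_set s v R S \<longleftrightarrow> S \<subseteq> R \<and> card S = min s (card R) \<and> (\<forall>a\<in>S. \<forall>b\<in>R - S. v b \<le> v a)"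

lemma top_set_raw_insert:
  assumes "top_set s v R S" "finite R" "i \<notin> R"
  shows "top_set s v (insert i R) (raw_insert s v i S)"
proof -
  have S: "S \<subseteq> R" "card S = min s (card R)" and dom: "\<And>a b. a \<in> S \<Longrightarrow> b \<in> R - S \<Longrightarrow> v b \<le> v a"
    using assms(1) by (auto simp: top_set_def)
  have fS: "finite S" using S assms finite_subset by auto
  have c: "card (insert i S) = Suc (card S)" using fS S assms by (simp add: card_insert_if subset_iff) blast
  show ?thesis
  proof (cases "card (insert i S) > s")
    case False
    then have "S = R" using c S assms(2) card_subset_eq[of R S] by auto
    then show ?thesis using False c assms S by (auto simp: top_set_def raw_insert_def Let_def)
  next
    case True
    define e where "e = min_key_elem v (insert i S)"
    have e: "e \<in> insert i S" "\<And>a. a \<in> insert i S \<Longrightarrow> v e \<le> v a"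
      using min_key_elem[where v = v and S = "insert i S"] fS by (auto simp: e_def)
    have cs: "card S = s" using True c S by auto
    have eq: "raw_insert s v i S = insert i S - {e}" using True by (simp add: raw_insert_def e_def Let_def)
    have "card (insert i S - {e}) = s" using e(1) c cs fS by simp
    moreover have "s \<le> card R" using S cs by simp
    moreover have "v b \<le> v a" if "a \<in> insert i S - {e}" "b \<in> insert i R - (insert i S - {e})" for a b
    proof (cases "b = e")
      case True then show ?thesis using e that by auto
    next
      case False
      then have b: "b \<in> R - S" using that by auto
      show ?thesis
      proof (cases "a = i")
        case False then show ?thesis using dom that b by auto
      next
        case True
        \<comment> \<open>The new item \<open>a = i\<close> survives, so the evicted
          \<open>e\<close> is an old one, and \<open>i\<close> beats \<open>b\<close> by way of
          \<open>e\<close>.\<close>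
        then have "e \<in> S" using e(1) that by auto
        then have "v b \<le> v e" using dom b by auto
        also have "\<dots> \<le> v a" using e(2) True by auto
        finally show ?thesis .
      qed
    qed
    ultimately show ?thesis using S assms by (auto simp: top_set_def eq)
  qed
qed

text \<open>This removes \<open>S\<close> from the probabilistic part: the smallest stored key is
  governed by a count over the deterministic set \<open>R\<close>. Positivity of \<open>x\<close>
  separates a genuine smallest key from the default \<open>0\<close> of a set that is not yet
  full.\<close>

lemma ukey_ge_iff:
  assumes top: "top_set s v R S" and "finite R" "s \<ge> 1" "x > 0"
  shows "ukey s v S \<ge> x \<longleftrightarrow> s \<le> card {i\<in>R. v i \<ge> x}"
proof
  have S: "S \<subseteq> R" "card S = min s (card R)" and dom: "\<And>a b. a \<in> S \<Longrightarrow> b \<in> R - S \<Longrightarrow> v b \<le> v a"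
    using top by (auto simp: top_set_def)
  have fS: "finite S" using S assms finite_subset by auto
  {
    assume u: "ukey s v S \<ge> x"
    then have c: "card S = s" and "Min (v ` S) \<ge> x" using \<open>x > 0\<close> by (auto simp: ukey_def split: if_splits)
    moreover have "S \<noteq> {}" using c assms by auto
    ultimately have "S \<subseteq> {i\<in>R. v i \<ge> x}" using fS S by auto
    then show "s \<le> card {i\<in>R. v i \<ge> x}" using c card_mono[of "{i\<in>R. v i \<ge> x}" S] assms by auto
  }
  assume a: "s \<le> card {i\<in>R. v i \<ge> x}"
  also have "\<dots> \<le> card R" using assms by (intro card_mono) auto
  finally have c: "card S = s" using S by auto
  then have ne: "S \<noteq> {}" using assms by auto
  have "v a \<ge> x" if aS: "a \<in> S" for a
  proof (rule ccontr)
    assume "\<not> v a \<ge> x"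
    \<comment> \<open>An item outside \<open>S\<close> is dominated by \<open>a\<close>, so all keys
      of at least \<open>x\<close> would lie in \<open>S - {a}\<close>, which has fewer than
      \<open>s\<close> elements.\<close>
    then have "{i\<in>R. v i \<ge> x} \<subseteq> S - {a}" using dom aS by force
    then have "card {i\<in>R. v i \<ge> x} \<le> card (S - {a})" using fS by (intro card_mono) auto
    then show False using a c aS fS assms by (simp add: card_Diff_singleton)
  qed
  then show "ukey s v S \<ge> x" using c ne fS by (simp add: ukey_def)
qed

lemma ukey_mono:
  assumes "top_set s v R S" "top_set s v R' S'" "finite R'" "R \<subseteq> R'" "s \<ge> 1" "ukey s v S > 0"
  shows "ukey s v S \<le> ukey s v S'"
proof -
  have "finite R" using assms finite_subset by auto
  have "s \<le> card {i\<in>R. v i \<ge> ukey s v S}"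
    using ukey_ge_iff[OF assms(1) \<open>finite R\<close> assms(5,6)] by simp
  also have "\<dots> \<le> card {i\<in>R'. v i \<ge> ukey s v S}" using assms by (intro card_mono) auto
  finally show ?thesis using ukey_ge_iff[OF assms(2,3,5,6)] by simp
qed

text \<open>The number of nonnegative integers \<open>j\<close> with \<open>r ^ j \<le> u\<close>, hence the number of threshold
  broadcasts by the time the smallest key is \<open>u\<close>.\<close>
definition levels_below :: "real \<Rightarrow> real \<Rightarrow> nat" where
  "levels_below r u = (if u \<ge> 1 then nat \<lfloor>log r u\<rfloor> + 1 else 0)"

lemma less_levels_below:
  assumes "r > 1" "j < levels_below r u"
  shows "r ^ j \<le> u"
proof -
  have u: "u \<ge> 1" "int j \<le> \<lfloor>log r u\<rfloor>" using assms by (auto simp: levels_below_def less_Suc_eq_le le_nat_iff split: if_splits)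
  then have "real j \<le> log r u" by linarith
  then have "r powr real j \<le> u" using assms u by (simp add: le_log_iff)
  then show ?thesis using assms by (simp add: powr_realpow)
qed

lemma levels_below_mono:
  assumes "r > 1" "u \<le> u'" shows "levels_below r u \<le> levels_below r u'"
  using assms by (auto simp: levels_below_def intro!: nat_mono floor_mono)

definition sampler_inv :: "nat \<Rightarrow> nat \<Rightarrow> (nat \<Rightarrow> real) \<Rightarrow> nat set \<Rightarrow> astate \<Rightarrow> bool" where
  "sampler_inv k s v R st \<longleftrightarrow> finite R \<and> top_set s v R (coordS st) \<and>
     (let u = ukey s v (coordS st); r = rpar k s in
       (u \<ge> 1 \<longrightarrow> last_lvl st = Some \<lfloor>log r u\<rfloor> \<and> (\<forall>q. site_tau st q = r powr \<lfloor>log r u\<rfloor>)) \<and>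
       (u < 1 \<longrightarrow> last_lvl st = None \<and> (\<forall>q. site_tau st q = 0)))"

lemma rpar_ge_2: "rpar k s \<ge> 2" by (simp add: rpar_def)

text \<open>The second claim is amortized: \<open>k * levels_below\<close> is the potential that
  pays for broadcasts. A broadcast requires the rounded logarithm of the smallest key to change, and
  by monotonicity it can only grow; powers that are skipped merely leave slack.\<close>

lemma sampler_inv_ins_S:
  assumes inv: "sampler_inv k s v R st" and "i \<notin> R" "s \<ge> 1"
  shows "sampler_inv k s v (insert i R) (ins_S k s v i st)" (is ?A)
    and "msgs (ins_S k s v i st) + k * levels_below (rpar k s) (ukey s v (coordS st))
      \<le> msgs st + k * levels_below (rpar k s) (ukey s v (coordS (ins_S k s v i st)))" (is ?B)
proof -
  define S where "S = coordS st"
  define S' where "S' = raw_insert s v i S"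
  define u where "u = ukey s v S"
  define u' where "u' = ukey s v S'"
  define r where "r = rpar k s"
  have r: "r > 1" using rpar_ge_2[of k s] by (simp add: r_def)
  have fin: "finite R" and top: "top_set s v R S" using inv by (auto simp: sampler_inv_def S_def)
  have top': "top_set s v (insert i R) S'" unfolding S'_def using top_set_raw_insert[OF top fin assms(2)] .
  have mono: "u > 0 \<Longrightarrow> u \<le> u'" unfolding u_def u'_def
    using ukey_mono[OF top top'] fin assms by auto
  have st: "u \<ge> 1 \<Longrightarrow> last_lvl st = Some \<lfloor>log r u\<rfloor> \<and> (\<forall>q. site_tau st q = r powr \<lfloor>log r u\<rfloor>)"
    "u < 1 \<Longrightarrow> last_lvl st = None \<and> (\<forall>q. site_tau st q = 0)"
    using inv by (auto simp: sampler_inv_def S_def r_def u_def Let_def)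
  have ins: "ins_S k s v i st = (if u' \<ge> 1 then
        (if last_lvl st \<noteq> Some \<lfloor>log r u'\<rfloor> then
          st\<lparr>coordS := S', last_lvl := Some \<lfloor>log r u'\<rfloor>, site_tau := (\<lambda>_. r powr of_int \<lfloor>log r u'\<rfloor>),
             msgs := msgs st + k\<rparr>
        else st\<lparr>coordS := S'\<rparr>)
     else st\<lparr>coordS := S', last_lvl := None\<rparr>)"
    by (simp add: ins_S_def Let_def S'_def S_def u'_def r_def)
  have S'eq: "coordS (ins_S k s v i st) = S'" by (simp add: ins)
  have lvl: "last_lvl (ins_S k s v i st) = (if u' \<ge> 1 then Some \<lfloor>log r u'\<rfloor> else None)" by (simp add: ins)
  have tau: "site_tau (ins_S k s v i st) q = (if u' \<ge> 1 then r powr \<lfloor>log r u'\<rfloor> else 0)" for q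
  proof (cases "u' \<ge> 1")
    case True
    then show ?thesis using st by (cases "u \<ge> 1") (auto simp: ins)
  next
    case False
    \<comment> \<open>The insertion leaves the thresholds alone in this branch. As the smallest key
      cannot fall back below \<open>1\<close>, they still have the value \<open>0\<close>.\<close>
    then have "u < 1" using mono by linarith
    then show ?thesis using st False by (auto simp: ins)
  qed
  show ?A unfolding sampler_inv_def Let_def S'eq lvl using fin top' tau
    by (auto simp: u'_def[symmetric] r_def[symmetric])
  have B: "levels_below r u \<le> levels_below r u'"
  proof (cases "u > 0")
    case False then show ?thesis by (simp add: levels_below_def)
  qed (use levels_below_mono r mono in auto)
  have "Suc (levels_below r u) \<le> levels_below r u'" if "u' \<ge> 1" "last_lvl st \<noteq> Some \<lfloor>log r u'\<rfloor>"
  proof (cases "u \<ge> 1")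
    case True
    then have "\<lfloor>log r u\<rfloor> \<noteq> \<lfloor>log r u'\<rfloor>" using st that by auto
    moreover have "\<lfloor>log r u\<rfloor> \<le> \<lfloor>log r u'\<rfloor>" using mono True r by (intro floor_mono) auto
    moreover have "0 \<le> \<lfloor>log r u\<rfloor>" using True r by simp
    ultimately have "nat \<lfloor>log r u\<rfloor> < nat \<lfloor>log r u'\<rfloor>" by linarith
    moreover have "levels_below r u = nat \<lfloor>log r u\<rfloor> + 1" "levels_below r u' = nat \<lfloor>log r u'\<rfloor> + 1"
      using True that(1) by (auto simp: levels_below_def)
    ultimately show ?thesis by linarith
  next
    case False
    then show ?thesis using that by (simp add: levels_below_def)
  qed
  then have "k * Suc (levels_below r u) \<le> k * levels_below r u'"
    if "u' \<ge> 1" "last_lvl st \<noteq> Some \<lfloor>log r u'\<rfloor>" using that mult_le_mono2 by blast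
  then have "msgs (ins_S k s v i st) + k * levels_below r u \<le> msgs st + k * levels_below r u'"
    using mult_le_mono2[OF B, of k] by (auto simp: ins)
  then show ?B unfolding S'eq by (simp add: r_def u_def u'_def S_def)
qed

lemma ins_S_unchanged [simp]:
  "coordD (ins_S k s v i st) = coordD st" "coord_sat (ins_S k s v i st) = coord_sat st"
  "site_sat (ins_S k s v i st) = site_sat st"
  by (auto simp: ins_S_def Let_def)

lemma fold_ins_S_unchanged [simp]:
  "coordD (fold (ins_S k s v) xs st) = coordD st" "coord_sat (fold (ins_S k s v) xs st) = coord_sat st"
  "site_sat (fold (ins_S k s v) xs st) = site_sat st"
  by (induction xs arbitrary: st) auto

lemma sampler_inv_fold:
  assumes "sampler_inv k s v R st" "distinct xs" "set xs \<inter> R = {}" "s \<ge> 1"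
  shows "sampler_inv k s v (R \<union> set xs) (fold (ins_S k s v) xs st)"
    and "msgs (fold (ins_S k s v) xs st) + k * levels_below (rpar k s) (ukey s v (coordS st))
      \<le> msgs st + k * levels_below (rpar k s) (ukey s v (coordS (fold (ins_S k s v) xs st)))"
proof -
  have "sampler_inv k s v (R \<union> set xs) (fold (ins_S k s v) xs st) \<and>
    msgs (fold (ins_S k s v) xs st) + k * levels_below (rpar k s) (ukey s v (coordS st))
      \<le> msgs st + k * levels_below (rpar k s) (ukey s v (coordS (fold (ins_S k s v) xs st)))"
    using assms
  proof (induction xs arbitrary: R st)
    case (Cons i xs)
    have 1: "sampler_inv k s v (insert i R) (ins_S k s v i st)"
      using sampler_inv_ins_S(1)[of k s v R st i] Cons.prems by auto
    have 2: "msgs (ins_S k s v i st) + k * levels_below (rpar k s) (ukey s v (coordS st))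
      \<le> msgs st + k * levels_below (rpar k s) (ukey s v (coordS (ins_S k s v i st)))"
      using sampler_inv_ins_S(2)[of k s v R st i] Cons.prems by auto
    show ?case using Cons.IH[OF 1] Cons.prems 2 by fastforce
  qed auto
  then show "sampler_inv k s v (R \<union> set xs) (fold (ins_S k s v) xs st)"
    "msgs (fold (ins_S k s v) xs st) + k * levels_below (rpar k s) (ukey s v (coordS st))
      \<le> msgs st + k * levels_below (rpar k s) (ukey s v (coordS (fold (ins_S k s v) xs st)))"
    by auto
qed

section \<open>The invariant of the whole protocol\<close>

locale sampling_run =
  fixes k s n :: nat and w :: "nat \<Rightarrow> real" and site :: "nat \<Rightarrow> nat"
  assumes k: "k \<ge> 1" and s: "s \<ge> 1" and w: "\<And>i. i < n \<Longrightarrow> w i \<ge> 1"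
begin

definition r :: real where "r = rpar k s"

definition lev :: "nat \<Rightarrow> nat" where "lev i = level r (w i)"

definition lev_items :: "nat \<Rightarrow> nat \<Rightarrow> nat set" where
  "lev_items t j = {i. i < t \<and> lev i = j}"

text \<open>Saturation of a level depends on the weights only, not on the exponentials; so the set of
  items that have left the level buffers by time \<open>t\<close> is deterministic.\<close>
definition full :: "nat \<Rightarrow> nat \<Rightarrow> bool" where
  "full t j \<longleftrightarrow> real (card (lev_items t j)) \<ge> 4 * r * real s"

definition released :: "nat \<Rightarrow> nat set" where
  "released t = {i. i < t \<and> full t (lev i)}"

definition key :: "(nat \<Rightarrow> real) \<Rightarrow> nat \<Rightarrow> real" where
  "key T i = w i / T i"

definition state :: "(nat \<Rightarrow> real) \<Rightarrow> nat \<Rightarrow> astate" where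
  "state T t = run k s w site T t"

definition sent :: "(nat \<Rightarrow> real) \<Rightarrow> nat \<Rightarrow> nat set" where
  "sent T t = {i. i < t \<and> full i (lev i) \<and> key T i > site_tau (state T i) (site i)}"

definition early :: "nat \<Rightarrow> nat set" where
  "early t = {i. i < t \<and> \<not> full i (lev i)}"

definition thr :: "(nat \<Rightarrow> real) \<Rightarrow> nat \<Rightarrow> real" where
  "thr T t = ukey s (key T) (coordS (state T t))"

lemma r: "r \<ge> 2" by (simp add: r_def rpar_ge_2)

lemma finite_lev_items [simp]: "finite (lev_items t j)" by (simp add: lev_items_def)
lemma finite_early [simp]: "finite (early t)" by (simp add: early_def)
lemma finite_sent [simp]: "finite (sent T t)" by (simp add: sent_def)
lemma finite_released [simp]: "finite (released t)" by (simp add: released_def)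

lemma capacity_pos: "4 * r * real s > 0" using r s by simp

lemma lev_items_Suc: "lev_items (Suc t) j = (if lev t = j then insert t (lev_items t j) else lev_items t j)"
  by (auto simp: lev_items_def less_Suc_eq)

lemma full_mono: "full t j \<Longrightarrow> t \<le> t' \<Longrightarrow> full t' j"
proof -
  assume "full t j" "t \<le> t'"
  moreover from this have "card (lev_items t j) \<le> card (lev_items t' j)"
    by (intro card_mono) (auto simp: lev_items_def)
  ultimately show "full t' j" by (simp add: full_def)
qed

lemma finite_full [simp]: "finite {j. full t j}"
proof (rule finite_subset)
  show "{j. full t j} \<subseteq> lev ` {..<t}"
  proof
    fix j assume "j \<in> {j. full t j}"
    then have "card (lev_items t j) > 0" using capacity_pos by (auto simp: full_def intro!: Nat.gr0I)
    then have "lev_items t j \<noteq> {}" by auto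
    then show "j \<in> lev ` {..<t}" by (auto simp: lev_items_def)
  qed
qed auto

lemma full_Suc: "full (Suc t) j \<longleftrightarrow> full t j \<or> (lev t = j \<and> full (Suc t) j)"
  using full_mono[of t j "Suc t"] by (auto simp: full_def lev_items_Suc)

lemma state_Suc: "state T (Suc t) = step k s w site T (state T t) t"
  by (simp add: state_def run_def)

text \<open>The four summands are the early messages, the saturation broadcasts, the regular
  messages and the threshold broadcasts. Only the last two depend on \<open>T\<close>.\<close>

definition run_inv :: "(nat \<Rightarrow> real) \<Rightarrow> nat \<Rightarrow> astate \<Rightarrow> bool" where
  "run_inv T t st \<longleftrightarrow> (\<forall>q j. site_sat st q j = full t j) \<and>
     (\<forall>j. coordD st j = (if full t j then {} else lev_items t j)) \<and>
     sampler_inv k s (key T) (released t) st \<and>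
     msgs st \<le> card (early t) + k * card {j. full t j} + card (sent T t)
       + k * levels_below r (ukey s (key T) (coordS st))"

lemma run_inv_init: "run_inv T 0 init_state"
  using capacity_pos s by (simp add: run_inv_def init_state_def full_def lev_items_def released_def
    sampler_inv_def top_set_def ukey_def not_le)

text \<open>Serves both ways of losing an item, rejection by the site and by the coordinator. A
  positive key that is at most \<open>u\<close> shows that \<open>u\<close> is not the default
  \<open>0\<close>, so \<open>S\<close> already has \<open>s\<close> elements.\<close>

lemma sampler_inv_skip:
  assumes inv: "sampler_inv k s v R st" and "i \<notin> R" "v i > 0" "v i \<le> ukey s v (coordS st)"
  shows "sampler_inv k s v (insert i R) st"
proof -
  have top: "top_set s v R (coordS st)" and "finite R" using inv by (auto simp: sampler_inv_def)
  then have S: "coordS st \<subseteq> R" "card (coordS st) = min s (card R)" by (auto simp: top_set_def)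
  then have f: "finite (coordS st)" using \<open>finite R\<close> finite_subset by auto
  have c: "card (coordS st) = s" and le: "v i \<le> Min (v ` coordS st)"
    using assms(3,4) by (auto simp: ukey_def split: if_splits)
  have "v i \<le> v a" if "a \<in> coordS st" for a using le f that by (meson Min_le finite_imageI imageI le_less_trans not_le)
  then have "top_set s v (insert i R) (coordS st)" using top c S \<open>finite R\<close>
    by (auto simp: top_set_def card_insert_if)
  then show ?thesis using inv by (auto simp: sampler_inv_def)
qed

lemma run_inv_step:
  assumes inv: "run_inv T t (state T t)" and "key T t > 0"
  shows "run_inv T (Suc t) (state T (Suc t))"
proof -
  define st where "st = state T t"
  define j where "j = lev t"
  define v where "v = key T"
  have v: "(\<lambda>m. w m / T m) = v" by (auto simp: v_def key_def)
  have sat: "site_sat st q j' = full t j'" and D: "coordD st j' = (if full t j' then {} else lev_items t j')"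
    and si: "sampler_inv k s v (released t) st" and
    ms: "msgs st \<le> card (early t) + k * card {j. full t j} + card (sent T t)
       + k * levels_below r (ukey s v (coordS st))" for q j'
    using inv by (auto simp: run_inv_def st_def v_def)
  have step: "state T (Suc t) = (if \<not> full t j then
       (let st1 = st\<lparr>msgs := msgs st + 1, coordD := (coordD st)(j := insert t (coordD st j))\<rparr> in
        if real (card (coordD st1 j)) \<ge> 4 * r * real s then
          (let st2 = fold (ins_S k s v) (sorted_list_of_set (coordD st1 j)) st1 in
           st2\<lparr>coordD := (coordD st2)(j := {}), coord_sat := (coord_sat st2)(j := True),
               site_sat := (\<lambda>q' j'. if j' = j then True else site_sat st2 q' j'),
               msgs := msgs st2 + k\<rparr>)
        else st1)
     else if v t > site_tau st (site t) then
       (let st1 = st\<lparr>msgs := msgs st + 1\<rparr> in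
        if v t > ukey s v (coordS st1) then ins_S k s v t st1 else st1)
     else st)"
    unfolding state_Suc st_def[symmetric] step_def Let_def v sat r_def[symmetric] lev_def[symmetric] j_def[symmetric] ..
  have tnot: "t \<notin> released t" by (auto simp: released_def)
  show ?thesis
  proof (cases "full t j")
    case False
    define st1 where "st1 = st\<lparr>msgs := msgs st + 1, coordD := (coordD st)(j := insert t (coordD st j))\<rparr>"
    have D1: "coordD st1 j = lev_items (Suc t) j" using D False by (simp add: st1_def lev_items_Suc j_def)
    have si1: "sampler_inv k s v (released t) st1" using si by (simp add: sampler_inv_def st1_def)
    have early: "early (Suc t) = insert t (early t)" "t \<notin> early t" using False by (auto simp: early_def j_def less_Suc_eq)
    have sent: "sent T (Suc t) = sent T t" using False by (auto simp: sent_def j_def less_Suc_eq)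
    show ?thesis
    proof (cases "full (Suc t) j")
      case f: False
      then have fs: "full (Suc t) = full t" using full_Suc by (auto simp: j_def)
      have "state T (Suc t) = st1" using False f D1 by (simp add: step full_def Let_def st1_def)
      moreover have "released (Suc t) = released t" using f by (auto simp: released_def fs j_def less_Suc_eq)
      ultimately show ?thesis using si1 ms D1 f sat D early sent by (auto simp: run_inv_def st1_def fs v_def lev_items_Suc j_def)
    next
      case f: True
      define st2 where "st2 = fold (ins_S k s v) (sorted_list_of_set (lev_items (Suc t) j)) st1"
      have st': "state T (Suc t) = st2\<lparr>coordD := (coordD st2)(j := {}), coord_sat := (coord_sat st2)(j := True),
               site_sat := (\<lambda>q' j'. if j' = j then True else site_sat st2 q' j'),
               msgs := msgs st2 + k\<rparr>" (is "_ = ?st'")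
        using False f D1 by (simp add: step full_def Let_def st1_def st2_def)
      have fs: "full (Suc t) j' = (full t j' \<or> j' = j)" for j' using full_Suc[of t] f by (auto simp: j_def)
      have rel: "released (Suc t) = released t \<union> lev_items (Suc t) j"
        by (auto simp: released_def fs lev_items_def j_def less_Suc_eq)
      have disj: "lev_items (Suc t) j \<inter> released t = {}" using False by (auto simp: released_def lev_items_def)
      have si2: "sampler_inv k s v (released (Suc t)) st2"
        and ms2: "msgs st2 + k * levels_below r (ukey s v (coordS st1)) \<le> msgs st1 + k * levels_below r (ukey s v (coordS st2))"
        using sampler_inv_fold[OF si1, of "sorted_list_of_set (lev_items (Suc t) j)"] disj s
        by (auto simp: rel st2_def r_def)
      have cf: "card {j. full (Suc t) j} = Suc (card {j. full t j})"
      proof -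
        have "{j. full (Suc t) j} = insert j {j. full t j}" by (auto simp: fs)
        then show ?thesis using False by simp
      qed
      have sat2: "site_sat st2 q j' = full t j'" "coordD st2 = coordD st1" for q j' using sat by (auto simp: st2_def st1_def)
      have D2: "coordD ?st' j' = (if full (Suc t) j' then {} else lev_items (Suc t) j')" for j'
        using D by (auto simp: sat2 fs st1_def lev_items_Suc j_def)
      have "sampler_inv k s v (released (Suc t)) ?st'" using si2 by (simp add: sampler_inv_def)
      moreover have "msgs ?st' \<le> card (early (Suc t)) + k * card {j. full (Suc t) j} + card (sent T (Suc t))
         + k * levels_below r (ukey s v (coordS ?st'))"
        using ms ms2 by (simp add: cf sent early st1_def)
      moreover have "site_sat ?st' q j' = full (Suc t) j'" for q j' by (simp add: sat2 fs)
      ultimately show ?thesis unfolding st' run_inv_def v_def[symmetric] using D2 by blast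
    qed
  next
    case True
    then have fs: "full (Suc t) = full t" using full_Suc by (auto simp: j_def)
    have rel: "released (Suc t) = insert t (released t)" using True by (auto simp: released_def fs j_def less_Suc_eq)
    have D': "(if full t j' then {} else lev_items t j') = (if full (Suc t) j' then {} else lev_items (Suc t) j')" for j'
      using True by (auto simp: fs lev_items_Suc j_def)
    have early: "early (Suc t) = early t" using True by (auto simp: early_def j_def less_Suc_eq)
    define u where "u = ukey s v (coordS st)"
    show ?thesis
    proof (cases "v t > site_tau st (site t)")
      case False
      \<comment> \<open>The threshold is \<open>u\<close> rounded down to a power of
        \<open>r\<close>, so a site never withholds an item that the coordinator would have
        inserted.\<close>
      have "site_tau st (site t) \<le> max u 0"
      proof (cases "u \<ge> 1")
        case u: True
        have "r powr \<lfloor>log r u\<rfloor> \<le> r powr (log r u)" using r by (intro powr_mono) auto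
        also have "\<dots> = u" using r u by simp
        finally show ?thesis using si u by (auto simp: sampler_inv_def Let_def u_def r_def)
      qed (use si in \<open>auto simp: sampler_inv_def Let_def u_def\<close>)
      moreover have "v t > 0" using assms by (simp add: v_def)
      ultimately have "v t \<le> u" using False by auto
      then have "sampler_inv k s v (released (Suc t)) st"
        unfolding rel using sampler_inv_skip[OF si tnot \<open>v t > 0\<close>] by (simp add: u_def)
      moreover have "state T (Suc t) = st" using True False by (simp add: step)
      moreover have "sent T (Suc t) = sent T t" using False by (auto simp: sent_def less_Suc_eq st_def v_def)
      ultimately show ?thesis using ms sat D' D by (simp add: run_inv_def fs early v_def)
    next
      case sentt: True
      have se: "sent T (Suc t) = insert t (sent T t)" "t \<notin> sent T t"
        using sentt True by (auto simp: sent_def less_Suc_eq st_def v_def j_def)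
      define st1 where "st1 = st\<lparr>msgs := msgs st + 1\<rparr>"
      have si1: "sampler_inv k s v (released t) st1" using si by (simp add: sampler_inv_def st1_def)
      show ?thesis
      proof (cases "v t > u")
        case vu: True
        have st': "state T (Suc t) = ins_S k s v t st1" using True sentt vu by (simp add: step st1_def u_def Let_def)
        have "sampler_inv k s v (released (Suc t)) (ins_S k s v t st1)"
          "msgs (ins_S k s v t st1) + k * levels_below r u \<le> msgs st1 + k * levels_below r (ukey s v (coordS (ins_S k s v t st1)))"
          unfolding rel using sampler_inv_ins_S[OF si1 tnot s] by (auto simp: u_def r_def st1_def)
        then show ?thesis unfolding st' using ms sat D' D se by (simp add: run_inv_def fs early v_def st1_def u_def)
      next
        case vu: False
        then have st': "state T (Suc t) = st1" using True sentt by (simp add: step st1_def u_def Let_def)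
        have "sampler_inv k s v (released (Suc t)) st1"
          unfolding rel using sampler_inv_skip[OF si1 tnot] vu assms by (auto simp: u_def st1_def v_def)
        then show ?thesis unfolding st' using ms sat D' D se by (simp add: run_inv_def fs early v_def st1_def)
      qed
    qed
  qed
qed

lemma run_inv_state:
  assumes "\<And>i. i < t \<Longrightarrow> T i > 0" "t \<le> n"
  shows "run_inv T t (state T t)"
  using assms
proof (induction t)
  case 0
  then show ?case using run_inv_init by (simp add: state_def run_def)
next
  case (Suc t)
  moreover have "key T t > 0" using Suc.prems w[of t] by (auto simp: key_def intro!: divide_pos_pos)
  ultimately show ?case using run_inv_step by auto
qed

end

section \<open>Exponential races\<close>

abbreviation Exp1 :: "real measure" where "Exp1 \<equiv> density lborel (exponential_density 1)"

lemma prob_space_Exp1: "prob_space Exp1"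
  by (rule prob_space_exponential_density) simp

interpretation Exp1: product_prob_space "\<lambda>_::nat. Exp1" UNIV
  by (intro product_prob_spaceI prob_space_Exp1)

lemma prob_space_expM: "prob_space (expM n)"
  unfolding expM_def by (intro prob_space_PiM prob_space_Exp1)

lemma emeasure_exponential_greaterThan:
  assumes "l > 0" "c \<ge> 0"
  shows "emeasure (density lborel (exponential_density l)) {c<..} = ennreal (exp (- l * c))"
proof -
  interpret prob_space "density lborel (exponential_density l)"
    using assms by (intro prob_space_exponential_density)
  have "distributed (density lborel (exponential_density l)) lborel (\<lambda>x. x) (exponential_density l)"
    by (auto simp: distributed_def distr_id2 exponential_density_nonneg assms intro!: distr_id2)
  from exponential_distributedD_gt[OF this assms(2,1)]
  show ?thesis by (simp add: emeasure_eq_measure greaterThan_def mult.commute)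
qed

lemma emeasure_Exp1_singleton: "emeasure Exp1 {c} = 0"
proof -
  have "AE x in lborel. ennreal (exponential_density 1 x) * indicator {c} x = 0"
    using AE_lborel_singleton[of c] by eventually_elim (simp add: indicator_def)
  then show ?thesis by (subst emeasure_density) (auto simp: nn_integral_0_iff_AE)
qed

text \<open>The weight \<open>exp (- b * t)\<close> is the chance that competitors of total rate
  \<open>b\<close> are still silent at time \<open>t\<close>. Multiplied by the density it gives
  \<open>1 / (1 + b)\<close> times the density of rate \<open>1 + b\<close>, the law of the earliest
  clock.\<close>

lemma nn_integral_Exp1_tail:
  assumes "c \<ge> 0" "b \<ge> 0"
  shows "(\<integral>\<^sup>+t. indicator {c<..} t * ennreal (exp (- b * t)) \<partial>Exp1) = ennreal (exp (- (1 + b) * c) / (1 + b))"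
proof -
  have "(\<integral>\<^sup>+t. indicator {c<..} t * ennreal (exp (- b * t)) \<partial>Exp1)
      = (\<integral>\<^sup>+t. ennreal (exponential_density 1 t) * (indicator {c<..} t * ennreal (exp (- b * t))) \<partial>lborel)"
    by (subst nn_integral_density) auto
  also have "\<dots> = (\<integral>\<^sup>+t. ennreal (1 / (1 + b)) * (ennreal (exponential_density (1 + b) t) * indicator {c<..} t) \<partial>lborel)"
  proof (intro nn_integral_cong)
    fix t :: real
    have "exp (- t) * exp (- b * t) = 1 / (1 + b) * ((1 + b) * exp (- t * (1 + b)))"
    proof -
      have "exp (- t) * exp (- b * t) = exp (- t * (1 + b))" by (simp add: exp_add[symmetric] algebra_simps)
      moreover have "1 + b \<noteq> 0" using assms by auto
      ultimately show ?thesis by (simp del: mult_minus_left)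
    qed
    then show "ennreal (exponential_density 1 t) * (indicator {c<..} t * ennreal (exp (- b * t)))
      = ennreal (1 / (1 + b)) * (ennreal (exponential_density (1 + b) t) * indicator {c<..} t)"
      using assms by (auto simp: exponential_density_def ennreal_mult'[symmetric] indicator_def simp del: mult_minus_left)
  qed
  also have "\<dots> = ennreal (1 / (1 + b)) * emeasure (density lborel (exponential_density (1 + b))) {c<..}"
    by (subst nn_integral_cmult) (auto simp: emeasure_density)
  also have "\<dots> = ennreal (exp (- (1 + b) * c) / (1 + b))"
    using assms emeasure_exponential_greaterThan[of "1 + b" c]
    by (simp add: ennreal_mult'[symmetric])
  finally show ?thesis .
qed

lemma emeasure_Exp1_greaterThan: "c \<ge> 0 \<Longrightarrow> emeasure Exp1 {c<..} = ennreal (exp (- c))"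
  using emeasure_exponential_greaterThan[of 1 c] by simp

lemma AE_Exp1_pos: "AE t in Exp1. t > 0"
proof -
  have "emeasure Exp1 {0<..} = 1" using emeasure_Exp1_greaterThan[of 0] by simp
  then show ?thesis using Exp1.M.AE_prob_1[of "{0<..}"] by (simp add: Exp1.M.emeasure_eq_measure)
qed

lemma measurable_expM_component [measurable]: "i < n \<Longrightarrow> (\<lambda>T. T i) \<in> borel_measurable (expM n)"
  unfolding expM_def by (rule measurable_component_singleton[where M = "\<lambda>_. Exp1", simplified]) simp

lemma AE_expM_component:
  assumes "i < n" "AE t in Exp1. Q t"
  shows "AE T in expM n. Q (T i)"
  unfolding expM_def using assms AE_PiM_component[of "{..<n}" "\<lambda>_. Exp1" i Q] prob_space_Exp1 by auto

lemma AE_expM_pos: "AE T in expM n. \<forall>i<n. T i > 0"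
proof -
  have "AE T in expM n. \<forall>i\<in>{..<n}. T i > 0"
    by (intro AE_finite_allI) (auto intro: AE_expM_component AE_Exp1_pos)
  then show ?thesis by auto
qed

lemma AE_expM_no_ties:
  assumes "\<And>i. i < n \<Longrightarrow> w i \<noteq> (0::real)"
  shows "AE T in expM n. \<forall>i<n. \<forall>j<n. i \<noteq> j \<longrightarrow> T i / w i \<noteq> T j / w j"
proof -
  have "AE T in expM n. T i / w i \<noteq> T j / w j" if ij: "i < n" "j < n" "i \<noteq> j" for i j
  proof -
    let ?J = "{..<n} - {i}"
    let ?A = "{T\<in>space (expM n). T i / w i = T j / w j}"
    have I: "insert i ?J = {..<n}" using ij by auto
    have [measurable]: "?A \<in> sets (expM n)" using ij by measurable
    \<comment> \<open>With \<open>T i\<close> integrated innermost, a tie confines it to a single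
      point, which is a null set.\<close>
    have "emeasure (expM n) ?A = (\<integral>\<^sup>+T. indicator ?A T \<partial>PiM (insert i ?J) (\<lambda>_. Exp1))"
      unfolding I expM_def[symmetric] by simp
    also have "\<dots> = (\<integral>\<^sup>+x. \<integral>\<^sup>+y. indicator ?A (x(i := y)) \<partial>Exp1 \<partial>PiM ?J (\<lambda>_. Exp1))"
      by (intro Exp1.product_nn_integral_insert) (simp, simp, unfold I expM_def[symmetric], simp)
    also have "\<dots> \<le> (\<integral>\<^sup>+x. 0 \<partial>PiM ?J (\<lambda>_. Exp1))"
    proof (intro nn_integral_mono)
      fix x :: "nat \<Rightarrow> real"
      have "(\<integral>\<^sup>+y. indicator ?A (x(i := y)) \<partial>Exp1) \<le> (\<integral>\<^sup>+y. indicator {x j / w j * w i} y \<partial>Exp1)"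
        using ij assms[of i] by (intro nn_integral_mono) (auto simp: indicator_def field_simps)
      also have "\<dots> = 0" using emeasure_Exp1_singleton by simp
      finally show "(\<integral>\<^sup>+y. indicator ?A (x(i := y)) \<partial>Exp1) \<le> 0" .
    qed
    finally have "emeasure (expM n) ?A = 0" by simp
    then show ?thesis by (intro AE_I[where N = ?A]) auto
  qed
  then have "AE T in expM n. \<forall>i\<in>{..<n}. \<forall>j\<in>{..<n}. i \<noteq> j \<longrightarrow> T i / w i \<noteq> T j / w j"
    by (intro AE_finite_allI) auto
  then show ?thesis by auto
qed

section \<open>Arrival orders of exponential clocks\<close>

locale race =
  fixes n :: nat and w :: "nat \<Rightarrow> real" and P :: "nat set"
  assumes P: "P \<subseteq> {..<n}" and w_pos: "\<And>i. i \<in> P \<Longrightarrow> w i > 0"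
begin

text \<open>The runner \<open>i\<close> arrives at time \<open>T i / w i\<close>, the reciprocal of its key; so the runners in \<open>S\<close>
  arrive first iff they are the ones with the largest keys.\<close>
definition arrive_first :: "nat set \<Rightarrow> (nat \<Rightarrow> real) set" where
  "arrive_first S = {T\<in>space (expM n). \<forall>b\<in>P - S. 0 < T b / w b \<and> (\<forall>a\<in>S. T a / w a < T b / w b)}"

definition arrive_next :: "nat set \<Rightarrow> nat \<Rightarrow> (nat \<Rightarrow> real) set" where
  "arrive_next S i = {T\<in>space (expM n). 0 < T i / w i \<and> (\<forall>a\<in>S. T a / w a < T i / w i) \<and>
     (\<forall>b\<in>P - insert i S. T i / w i < T b / w b)}"

lemma finite_P: "finite P" using P finite_subset by auto

lemma sets_arrive [measurable]:
  assumes "S \<subseteq> P"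
  shows "arrive_first S \<in> sets (expM n)" "i \<in> P \<Longrightarrow> arrive_next S i \<in> sets (expM n)"
proof -
  have [measurable]: "(\<lambda>T. T a) \<in> borel_measurable (expM n)" if "a \<in> P" for a using that P by auto
  have [simp]: "finite S" "finite (P - S)" "finite (P - insert i S)" using assms finite_P finite_subset by auto
  have [simp]: "countable S" "countable (P - S)" "countable (P - insert i S)" by (auto intro: countable_finite)
  show "arrive_first S \<in> sets (expM n)" unfolding arrive_first_def
    by (intro sets.sets_Collect_finite_All sets.sets_Collect_conj borel_measurable_less) (use assms P in auto)
  show "i \<in> P \<Longrightarrow> arrive_next S i \<in> sets (expM n)" unfolding arrive_next_def
    by (intro sets.sets_Collect_finite_All sets.sets_Collect_conj borel_measurable_less) (use assms P in auto)
qed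

text \<open>Fix the clocks in \<open>S\<close> and let \<open>X\<close> be their last arrival. By
  memorylessness the others all exceed \<open>X\<close> with probability
  \<open>exp (- ?W * X)\<close>, and which of them comes first is then independent of
  \<open>X\<close>. Hence the inner integrals for both events are proportional with the constant
  factor \<open>w i / ?W\<close>, and the outer integral over \<open>S\<close> is never
  evaluated.\<close>

lemma emeasure_arrive_next:
  assumes S: "S \<subseteq> P" and i: "i \<in> P - S"
  shows "emeasure (expM n) (arrive_next S i)
    = ennreal (w i / (\<Sum>j\<in>P - S. w j)) * emeasure (expM n) (arrive_first S)"
proof -
  have iP: "i \<in> P" using i by simp
  define J where "J = {..<n} - S"
  define J' where "J' = J - {i}"
  let ?W = "\<Sum>j\<in>P - S. w j"
  \<comment> \<open>The extra \<open>0\<close> gives \<open>X\<close> a value for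
    \<open>S = {}\<close> and absorbs the positivity conditions in both events.\<close>
  define X where "X = (\<lambda>x. Max (insert 0 ((\<lambda>a. x a / w a) ` S)))"
  have fS: "finite S" and fJ: "finite J" "finite J'" using S finite_P finite_subset by (auto simp: J_def J'_def)
  have SJ: "S \<union> J = {..<n}" "S \<inter> J = {}" using S P by (auto simp: J_def)
  have J: "J = insert i J'" "i \<notin> J'" using i P by (auto simp: J'_def J_def)
  have PS: "P - S \<subseteq> J" "P - insert i S \<subseteq> J'" using P by (auto simp: J_def J'_def)
  have X_less: "X x < y \<longleftrightarrow> 0 < y \<and> (\<forall>a\<in>S. x a / w a < y)" for x y
    unfolding X_def using fS by (subst Max_less_iff) auto
  have X_nonneg: "X x \<ge> 0" for x unfolding X_def using fS by (intro Max_ge) auto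
  have W: "?W > 0" using i w_pos finite_P by (intro sum_pos) auto
  have fold: "emeasure (expM n) A
      = (\<integral>\<^sup>+x. \<integral>\<^sup>+y. indicator A (merge S J (x, y)) \<partial>PiM J (\<lambda>_. Exp1) \<partial>PiM S (\<lambda>_. Exp1))"
    if "A \<in> sets (expM n)" for A
  proof -
    have "emeasure (expM n) A = (\<integral>\<^sup>+T. indicator A T \<partial>PiM (S \<union> J) (\<lambda>_. Exp1))"
      using that unfolding SJ expM_def[symmetric] by simp
    also have "\<dots> = (\<integral>\<^sup>+x. \<integral>\<^sup>+y. indicator A (merge S J (x, y)) \<partial>PiM J (\<lambda>_. Exp1) \<partial>PiM S (\<lambda>_. Exp1))"
      using SJ fS fJ that by (intro Exp1.product_nn_integral_fold) (auto simp: expM_def[symmetric])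
    finally show ?thesis .
  qed
  have space: "merge S J (x, y) \<in> space (expM n)" if "y \<in> space (PiM J (\<lambda>_. Exp1))" "x \<in> space (PiM S (\<lambda>_. Exp1))" for x y
    using that SJ by (auto simp: expM_def space_PiM PiE_iff merge_def extensional_def)
  \<comment> \<open>Clocks of indices outside \<open>P\<close> remain in the product space; the
    factor \<open>1\<close> integrates them out.\<close>
  have tail: "(\<integral>\<^sup>+y. (if b \<in> P then indicator {w b * c<..} y else 1) \<partial>Exp1) = (if b \<in> P then ennreal (exp (- w b * c)) else 1)"
    if "c \<ge> 0" for b c
    using that w_pos[of b] emeasure_Exp1_greaterThan[of "w b * c"] prob_space.emeasure_space_1[OF prob_space_Exp1]
    by (auto simp: less_imp_le)
  have prod_tail: "(\<Prod>b\<in>K. if b \<in> P then ennreal (exp (- w b * c)) else 1) = ennreal (exp (- (\<Sum>b\<in>K \<inter> P. w b) * c))"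
    if "finite K" for K c
    using that by (simp add: prod.If_cases prod_ennreal exp_sum[symmetric] sum_distrib_right sum_negf Int_def)
  have first: "(\<integral>\<^sup>+y. indicator (arrive_first S) (merge S J (x, y)) \<partial>PiM J (\<lambda>_. Exp1)) = ennreal (exp (- ?W * X x))"
    if x: "x \<in> space (PiM S (\<lambda>_. Exp1))" for x
  proof -
    have "(\<integral>\<^sup>+y. indicator (arrive_first S) (merge S J (x, y)) \<partial>PiM J (\<lambda>_. Exp1))
        = (\<integral>\<^sup>+y. (\<Prod>b\<in>J. if b \<in> P then indicator {w b * X x<..} (y b) else 1) \<partial>PiM J (\<lambda>_. Exp1))"
    proof (intro nn_integral_cong)
      fix y assume y: "y \<in> space (PiM J (\<lambda>_. Exp1))"
      have m: "merge S J (x, y) a = x a" if "a \<in> S" for a using that by (simp add: merge_def)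
      have m': "merge S J (x, y) a = y a" if "a \<in> P - S" for a using that PS by (auto simp: merge_def)
      have "merge S J (x, y) \<in> arrive_first S \<longleftrightarrow> (\<forall>b\<in>P - S. X x < y b / w b)"
        using space[OF y x] by (simp add: arrive_first_def m m' X_less)
      also have "\<dots> \<longleftrightarrow> (\<forall>b\<in>P - S. w b * X x < y b)" using w_pos by (auto simp: field_simps)
      also have "\<dots> \<longleftrightarrow> (\<forall>b\<in>J. b \<in> P \<longrightarrow> w b * X x < y b)" using PS SJ by auto
      finally have *: "merge S J (x, y) \<in> arrive_first S \<longleftrightarrow> (\<forall>b\<in>J. b \<in> P \<longrightarrow> w b * X x < y b)" .
      have "(\<Prod>b\<in>J. if b \<in> P then indicator {w b * X x<..} (y b) else 1) = (if \<forall>b\<in>J. b \<in> P \<longrightarrow> w b * X x < y b then 1 else (0::ennreal))"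
        using fJ by (auto intro!: prod.neutral simp: indicator_def)
      then show "indicator (arrive_first S) (merge S J (x, y)) = (\<Prod>b\<in>J. if b \<in> P then indicator {w b * X x<..} (y b) else (1::ennreal))"
        by (simp add: indicator_def *)
    qed
    also have "\<dots> = (\<Prod>b\<in>J. \<integral>\<^sup>+y. (if b \<in> P then indicator {w b * X x<..} y else 1) \<partial>Exp1)"
      using fJ by (intro Exp1.product_nn_integral_prod) auto
    also have "\<dots> = ennreal (exp (- ?W * X x))"
    proof -
      have "J \<inter> P = P - S" using PS SJ by auto
      then show ?thesis using fJ by (simp add: tail X_nonneg prod_tail del: mult_minus_left)
    qed
    finally show ?thesis .
  qed
  have "next": "(\<integral>\<^sup>+y. indicator (arrive_next S i) (merge S J (x, y)) \<partial>PiM J (\<lambda>_. Exp1)) = ennreal (w i / ?W) * ennreal (exp (- ?W * X x))"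
    if x: "x \<in> space (PiM S (\<lambda>_. Exp1))" for x
  proof -
    let ?f = "\<lambda>T. indicator {w i * X x<..} (T i) * (\<Prod>b\<in>J'. if b \<in> P then indicator {w b * (T i / w i)<..} (T b) else 1) :: ennreal"
    have wi: "w i > 0" using i w_pos by auto
    have mJ [measurable]: "(\<lambda>T. T b) \<in> borel_measurable (PiM J (\<lambda>_. Exp1))" if "b \<in> J" for b
      using that by (rule measurable_component_singleton[where M = "\<lambda>_. Exp1", simplified])
    have [measurable]: "(\<lambda>T. T b) \<in> borel_measurable (PiM J (\<lambda>_. Exp1))" if "b \<in> J'" for b
      using that by (intro mJ) (simp add: J'_def)
    have [measurable]: "(\<lambda>T. T i) \<in> borel_measurable (PiM J (\<lambda>_. Exp1))"
      by (intro mJ) (simp add: J)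
    have meas: "?f \<in> borel_measurable (PiM J (\<lambda>_. Exp1))"
      unfolding indicator_def greaterThan_iff of_bool_def
      by (intro borel_measurable_times_ennreal borel_measurable_prod_ennreal) measurable
    have "(\<integral>\<^sup>+y. indicator (arrive_next S i) (merge S J (x, y)) \<partial>PiM J (\<lambda>_. Exp1)) = (\<integral>\<^sup>+y. ?f y \<partial>PiM J (\<lambda>_. Exp1))"
    proof (intro nn_integral_cong)
      fix y assume y: "y \<in> space (PiM J (\<lambda>_. Exp1))"
      have m: "merge S J (x, y) a = x a" if "a \<in> S" for a using that by (simp add: merge_def)
      have m': "merge S J (x, y) a = y a" if "a \<in> P - S" for a using that PS by (auto simp: merge_def)
      have mi: "merge S J (x, y) i = y i" using m' i by auto
      have "merge S J (x, y) \<in> arrive_next S i \<longleftrightarrow> X x < y i / w i \<and> (\<forall>b\<in>P - insert i S. y i / w i < y b / w b)"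
        using space[OF y x] by (simp add: arrive_next_def m m' mi X_less)
      also have "\<dots> \<longleftrightarrow> w i * X x < y i \<and> (\<forall>b\<in>P - insert i S. w b * (y i / w i) < y b)"
        using w_pos wi by (auto simp: pos_less_divide_eq mult.commute)
      also have "\<dots> \<longleftrightarrow> w i * X x < y i \<and> (\<forall>b\<in>J'. b \<in> P \<longrightarrow> w b * (y i / w i) < y b)" using PS SJ J by auto
      finally have *: "merge S J (x, y) \<in> arrive_next S i \<longleftrightarrow> w i * X x < y i \<and> (\<forall>b\<in>J'. b \<in> P \<longrightarrow> w b * (y i / w i) < y b)" .
      have "(\<Prod>b\<in>J'. if b \<in> P then indicator {w b * (y i / w i)<..} (y b) else 1)
         = (if \<forall>b\<in>J'. b \<in> P \<longrightarrow> w b * (y i / w i) < y b then 1 else (0::ennreal))"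
        using fJ by (auto intro!: prod.neutral simp: indicator_def)
      then show "indicator (arrive_next S i) (merge S J (x, y)) = ?f y"
        by (simp add: indicator_def * del: times_divide_eq_right)
    qed
    also have "\<dots> = (\<integral>\<^sup>+t. \<integral>\<^sup>+y. ?f (y(i := t)) \<partial>PiM J' (\<lambda>_. Exp1) \<partial>Exp1)"
      using meas fJ J unfolding J(1) by (intro Exp1.product_nn_integral_insert_rev) auto
    \<comment> \<open>Given \<open>T i = t\<close>, item \<open>i\<close> arrives at time
      \<open>t / w i\<close>, and competitors of total rate \<open>?W - w i\<close> must outlast it.
      Relative to the unit clock \<open>t\<close> their rate is
      \<open>(?W - w i) / w i\<close>.\<close>
    also have "\<dots> = (\<integral>\<^sup>+t. indicator {w i * X x<..} t * ennreal (exp (- ((?W - w i) / w i) * t)) \<partial>Exp1)"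
    proof (intro nn_integral_cong)
      fix t :: real
      have mJ' [measurable]: "(\<lambda>T. T b) \<in> borel_measurable (PiM J' (\<lambda>_. Exp1))" if "b \<in> J'" for b
        using that by (rule measurable_component_singleton[where M = "\<lambda>_. Exp1", simplified])
      have JP: "J' \<inter> P = P - insert i S" using PS SJ J by auto
      have sumP: "(\<Sum>b\<in>P - insert i S. w b) = ?W - w i"
        using i finite_P sum.remove[of "P - S" i w] by (simp add: Diff_insert[symmetric])
      have "(\<integral>\<^sup>+y. ?f (y(i := t)) \<partial>PiM J' (\<lambda>_. Exp1))
          = (\<integral>\<^sup>+y. indicator {w i * X x<..} t * (\<Prod>b\<in>J'. if b \<in> P then indicator {w b * (t / w i)<..} (y b) else 1) \<partial>PiM J' (\<lambda>_. Exp1))"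
        using J by (intro nn_integral_cong arg_cong2[where f = "(*)"] prod.cong) auto
      also have "\<dots> = indicator {w i * X x<..} t * (\<integral>\<^sup>+y. (\<Prod>b\<in>J'. if b \<in> P then indicator {w b * (t / w i)<..} (y b) else 1) \<partial>PiM J' (\<lambda>_. Exp1))"
        using mJ' unfolding indicator_def greaterThan_iff of_bool_def
        by (intro nn_integral_cmult borel_measurable_prod_ennreal) measurable
      also have "(\<integral>\<^sup>+y. (\<Prod>b\<in>J'. if b \<in> P then indicator {w b * (t / w i)<..} (y b) else 1) \<partial>PiM J' (\<lambda>_. Exp1))
         = (\<Prod>b\<in>J'. \<integral>\<^sup>+y. (if b \<in> P then indicator {w b * (t / w i)<..} y else 1) \<partial>Exp1)"
        using fJ by (intro Exp1.product_nn_integral_prod) auto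
      also have "indicator {w i * X x<..} t * \<dots> = indicator {w i * X x<..} t * ennreal (exp (- ((?W - w i) / w i) * t))"
      proof (cases "w i * X x < t")
        case True
        have "0 \<le> w i * X x" using wi X_nonneg by simp
        then have "t / w i \<ge> 0" using True wi by simp
        have "- (\<Sum>b\<in>P - insert i S. w b) * (t / w i) = - ((?W - w i) / w i) * t"
          unfolding sumP by (simp only: minus_divide_left times_divide_eq_left times_divide_eq_right)
        then show ?thesis unfolding tail[OF \<open>t / w i \<ge> 0\<close>] prod_tail[OF fJ(2)] JP by (rule arg_cong)
      qed simp
      finally show "(\<integral>\<^sup>+y. ?f (y(i := t)) \<partial>PiM J' (\<lambda>_. Exp1)) = indicator {w i * X x<..} t * ennreal (exp (- ((?W - w i) / w i) * t))" .
    qed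
    also have "\<dots> = ennreal (exp (- (1 + (?W - w i) / w i) * (w i * X x)) / (1 + (?W - w i) / w i))"
    proof (rule nn_integral_Exp1_tail)
      have "w i \<le> ?W" using i finite_P w_pos by (intro member_le_sum) (auto simp: less_imp_le)
      then show "(?W - w i) / w i \<ge> 0" using wi by simp
    qed (use wi X_nonneg in auto)
    also have "1 + (?W - w i) / w i = ?W / w i" using wi by (simp add: field_simps)
    also have "ennreal (exp (- (?W / w i) * (w i * X x)) / (?W / w i)) = ennreal (w i / ?W) * ennreal (exp (- ?W * X x))"
      using wi W by (simp add: ennreal_mult'[symmetric] mult.commute)
    finally show ?thesis .
  qed
  have fm: "(\<lambda>x. \<integral>\<^sup>+y. indicator (arrive_first S) (merge S J (x, y)) \<partial>PiM J (\<lambda>_. Exp1)) \<in> borel_measurable (PiM S (\<lambda>_. Exp1))"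
  proof -
    have PJ: "sigma_finite_measure (PiM J (\<lambda>_. Exp1))" by (rule product_sigma_finite.sigma_finite[OF Exp1.product_sigma_finite_axioms fJ(1)])
    have "merge S J \<in> PiM S (\<lambda>_. Exp1) \<Otimes>\<^sub>M PiM J (\<lambda>_. Exp1) \<rightarrow>\<^sub>M expM n"
      using measurable_merge[of S J "\<lambda>_. Exp1"] unfolding SJ expM_def .
    then have "(\<lambda>p. indicator (arrive_first S) (merge S J p) :: ennreal) \<in> borel_measurable (PiM S (\<lambda>_. Exp1) \<Otimes>\<^sub>M PiM J (\<lambda>_. Exp1))"
      by (rule measurable_compose[OF _ borel_measurable_indicator[OF sets_arrive(1)[OF S]]])
    from sigma_finite_measure.borel_measurable_nn_integral_fst[OF PJ this] show ?thesis .
  qed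
  have "emeasure (expM n) (arrive_next S i)
      = (\<integral>\<^sup>+x. ennreal (w i / ?W) * (\<integral>\<^sup>+y. indicator (arrive_first S) (merge S J (x, y)) \<partial>PiM J (\<lambda>_. Exp1)) \<partial>PiM S (\<lambda>_. Exp1))"
    unfolding fold[OF sets_arrive(2)[OF S iP]] by (intro nn_integral_cong) (simp only: first "next")
  also have "\<dots> = ennreal (w i / ?W) * (\<integral>\<^sup>+x. \<integral>\<^sup>+y. indicator (arrive_first S) (merge S J (x, y)) \<partial>PiM J (\<lambda>_. Exp1) \<partial>PiM S (\<lambda>_. Exp1))"
    using fm by (rule nn_integral_cmult)
  also have "\<dots> = ennreal (w i / ?W) * emeasure (expM n) (arrive_first S)"
    unfolding fold[OF sets_arrive(1)[OF S]] ..
  finally show ?thesis .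
qed

end

section \<open>Sampling without replacement as a recursion on mass functions\<close>

lemma pmf_weighted_pick:
  assumes "finite B" "B \<noteq> {}" "\<And>i. i \<in> B \<Longrightarrow> w i > 0"
  shows "pmf (weighted_pick w B) i = (if i \<in> B then w i / (\<Sum>j\<in>B. w j) else 0)"
proof -
  have W: "(\<Sum>j\<in>B. w j) > 0" using assms by (intro sum_pos) auto
  have "(\<integral>\<^sup>+i. ennreal (if i \<in> B then w i / (\<Sum>j\<in>B. w j) else 0) \<partial>count_space UNIV)
      = (\<Sum>i\<in>B. ennreal (w i / (\<Sum>j\<in>B. w j)))"
    using assms W by (subst nn_integral_count_space'[of B]) (auto simp: less_imp_le intro!: sum.cong)
  also have "\<dots> = ennreal (\<Sum>i\<in>B. w i / (\<Sum>j\<in>B. w j))"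
    using assms W by (intro sum_ennreal) (auto simp: less_imp_le)
  also have "(\<Sum>i\<in>B. w i / (\<Sum>j\<in>B. w j)) = 1" using W by (simp add: sum_divide_distrib[symmetric])
  finally show ?thesis unfolding weighted_pick_def
    using assms W by (subst pmf_embed_pmf) (auto simp: less_imp_le)
qed

lemma set_pmf_weighted_pick:
  assumes "finite B" "B \<noteq> {}" "\<And>i. i \<in> B \<Longrightarrow> w i > 0"
  shows "set_pmf (weighted_pick w B) \<subseteq> B"
  using pmf_weighted_pick[of B w] assms by (auto simp: set_pmf_iff split: if_splits)

lemma set_pmf_swor:
  assumes "finite P" "m \<le> card P" "\<And>i. i \<in> P \<Longrightarrow> w i > 0"
  shows "set_pmf (swor w P m) \<subseteq> {S. S \<subseteq> P \<and> card S = m}"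
  using assms(2)
proof (induction m)
  case (Suc m)
  show ?case
  proof
    fix A assume "A \<in> set_pmf (swor w P (Suc m))"
    then obtain S where S: "S \<in> set_pmf (swor w P m)"
      and A: "A \<in> set_pmf (if P - S = {} then return_pmf S else map_pmf (\<lambda>i. insert i S) (weighted_pick w (P - S)))"
      by auto
    have S': "S \<subseteq> P" "card S = m" using S Suc by auto
    then have ne: "P - S \<noteq> {}" using Suc.prems assms(1) by (metis Diff_eq_empty_iff Suc_n_not_le_n subset_antisym)
    then obtain i where "i \<in> P - S" "A = insert i S"
      using A set_pmf_weighted_pick[of "P - S" w] assms by auto
    moreover have "finite S" using S' assms(1) finite_subset by auto
    ultimately show "A \<in> {S. S \<subseteq> P \<and> card S = Suc m}" using S' by (auto simp: card_insert_if)
  qed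
qed auto

text \<open>The last draw adds a new item, so the preceding sample must be \<open>A - {i}\<close>
  for some \<open>i \<in> A\<close>, and from it only the draw of \<open>i\<close> leads to
  \<open>A\<close>. The integral over all samples of size \<open>m\<close> thus collapses to a
  finite sum.\<close>

lemma pmf_swor_Suc:
  assumes "finite P" "A \<subseteq> P" "card A = Suc m" "\<And>i. i \<in> P \<Longrightarrow> w i > 0"
  shows "pmf (swor w P (Suc m)) A = (\<Sum>i\<in>A. pmf (swor w P m) (A - {i}) * (w i / (\<Sum>j\<in>P - (A - {i}). w j)))"
proof -
  have fA: "finite A" using assms finite_subset by auto
  have mP: "Suc m \<le> card P" using assms card_mono by metis
  let ?f = "\<lambda>S. if P - S = {} then return_pmf S else map_pmf (\<lambda>i. insert i S) (weighted_pick w (P - S))"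
  have U: "S \<in> (\<lambda>i. A - {i}) ` A" if S: "S \<in> set_pmf (swor w P m)" and nz: "pmf (?f S) A \<noteq> 0" for S
  proof -
    have S': "S \<subseteq> P" "card S = m" using set_pmf_swor[of P m w] S assms mP by auto
    then have ne: "P - S \<noteq> {}" using mP assms(1) by (metis Diff_eq_empty_iff Suc_n_not_le_n subset_antisym)
    then obtain i where "i \<in> P - S" "A = insert i S"
      using nz set_pmf_weighted_pick[of "P - S" w] assms by (auto simp: set_pmf_iff[symmetric] image_iff)
    then show ?thesis by (intro image_eqI[of _ _ i]) auto
  qed
  have fi: "pmf (?f (A - {i})) A = w i / (\<Sum>j\<in>P - (A - {i}). w j)" if i: "i \<in> A" for i
  proof -
    have ne: "P - (A - {i}) \<noteq> {}" using assms i by auto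
    have "pmf (?f (A - {i})) A = measure (weighted_pick w (P - (A - {i}))) ((\<lambda>j. insert j (A - {i})) -` {A})"
      using ne by (simp add: pmf_map)
    also have "(\<lambda>j. insert j (A - {i})) -` {A} = {i}"
    proof -
      have "j = i" if "insert j (A - {i}) = A" for j
      proof -
        have "i \<in> insert j (A - {i})" using that i by simp
        then show ?thesis by auto
      qed
      then show ?thesis using i by auto
    qed
    also have "measure (weighted_pick w (P - (A - {i}))) {i} = w i / (\<Sum>j\<in>P - (A - {i}). w j)"
      using assms i ne by (subst measure_pmf_single, subst pmf_weighted_pick) auto
    finally show ?thesis .
  qed
  have inj: "inj_on (\<lambda>i. A - {i}) A" by (auto simp: inj_on_def)
  have "pmf (swor w P (Suc m)) A = (\<integral>S. pmf (?f S) A \<partial>swor w P m)" by (simp add: pmf_bind)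
  also have "\<dots> = (\<Sum>S\<in>(\<lambda>i. A - {i}) ` A. pmf (?f S) A * pmf (swor w P m) S)"
    using U fA by (intro integral_measure_pmf_real) auto
  also have "\<dots> = (\<Sum>i\<in>A. pmf (?f (A - {i})) A * pmf (swor w P m) (A - {i}))"
    by (subst sum.reindex[OF inj]) simp
  also have "\<dots> = (\<Sum>i\<in>A. pmf (swor w P m) (A - {i}) * (w i / (\<Sum>j\<in>P - (A - {i}). w j)))"
    by (intro sum.cong refl) (simp only: fi mult.commute)
  finally show ?thesis .
qed

section \<open>The arrival law satisfies the sampling recursion\<close>

context race
begin

definition no_ties :: "(nat \<Rightarrow> real) \<Rightarrow> bool" where
  "no_ties T \<longleftrightarrow> (\<forall>i\<in>P. T i > 0) \<and> inj_on (\<lambda>i. T i / w i) P"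

lemma AE_no_ties: "AE T in expM n. no_ties T"
proof -
  let ?w = "\<lambda>i. if i \<in> P then w i else 1"
  have "?w i \<noteq> 0" for i using w_pos[of i] by auto
  from AE_expM_no_ties[of n ?w, OF this] AE_expM_pos[of n] show ?thesis
  proof eventually_elim
    case (elim T)
    have lt: "i < n" if "i \<in> P" for i using that P by auto
    have "T i / w i \<noteq> T j / w j" if "i \<in> P" "j \<in> P" "i \<noteq> j" for i j
      using elim(1)[rule_format, OF lt[OF that(1)] lt[OF that(2)] that(3)] that by simp
    then have "inj_on (\<lambda>i. T i / w i) P" by (intro inj_onI) blast
    then show ?case using elim(2) lt unfolding no_ties_def by blast
  qed
qed

text \<open>Splitting by the last arrival within \<open>A\<close> yields the sum over
  \<open>i \<in> A\<close> that appears in \<open>pmf_swor_Suc\<close>. Absence of ties makes the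
  last arrival strictly later than the rest of \<open>A\<close>.\<close>

lemma arrive_first_iff:
  assumes "A \<subseteq> P" "A \<noteq> {}" "no_ties T" "T \<in> space (expM n)"
  shows "T \<in> arrive_first A \<longleftrightarrow> (\<exists>i\<in>A. T \<in> arrive_next (A - {i}) i)"
proof -
  have fA: "finite A" using assms finite_P finite_subset by auto
  have pos: "T i / w i > 0" if "i \<in> P" for i using that assms w_pos by (auto simp: no_ties_def)
  have inj: "inj_on (\<lambda>i. T i / w i) A" using assms inj_on_subset by (auto simp: no_ties_def)
  show ?thesis
  proof
    assume T: "T \<in> arrive_first A"
    have "Max ((\<lambda>i. T i / w i) ` A) \<in> (\<lambda>i. T i / w i) ` A" using fA assms(2) by (intro Max_in) auto
    then obtain i where i: "i \<in> A" "Max ((\<lambda>i. T i / w i) ` A) = T i / w i" by blast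
    have max: "T a / w a \<le> T i / w i" if "a \<in> A" for a
      using that fA unfolding i(2)[symmetric] by (intro Max_ge) auto
    have "T a / w a < T i / w i" if "a \<in> A - {i}" for a
    proof -
      have "T a / w a \<noteq> T i / w i" using inj_onD[OF inj, of a i] that i(1) by blast
      then show ?thesis using max[of a] that by simp
    qed
    then have "T \<in> arrive_next (A - {i}) i" using T i pos assms
      by (auto simp: arrive_first_def arrive_next_def insert_absorb)
    then show "\<exists>i\<in>A. T \<in> arrive_next (A - {i}) i" using i by auto
  next
    assume "\<exists>i\<in>A. T \<in> arrive_next (A - {i}) i"
    then obtain i where i: "i \<in> A" and T: "T \<in> arrive_next (A - {i}) i" by auto
    have "T a / w a < T b / w b" if "a \<in> A" "b \<in> P - A" for a b
    proof -
      have "T i / w i < T b / w b" using that i T by (auto simp: arrive_next_def insert_absorb)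
      moreover have "T a / w a \<le> T i / w i" using that T by (cases "a = i") (auto simp: arrive_next_def intro: less_imp_le)
      ultimately show ?thesis by simp
    qed
    then show "T \<in> arrive_first A" using pos assms by (auto simp: arrive_first_def)
  qed
qed

lemma prob_arrive_first:
  assumes "A \<subseteq> P"
  shows "measure (expM n) (arrive_first A) = pmf (swor w P (card A)) A"
  using assms
proof (induction "card A" arbitrary: A)
  case 0
  interpret prob_space "expM n" by (rule prob_space_expM)
  have "A = {}" using 0 finite_P finite_subset by fastforce
  moreover have "AE T in expM n. T \<in> arrive_first {}" using AE_no_ties AE_space
    by eventually_elim (use w_pos in \<open>auto simp: arrive_first_def no_ties_def\<close>)
  then have "measure (expM n) (arrive_first {}) = 1" using prob_eq_1[of "arrive_first {}"] sets_arrive(1)[of "{}"] by simp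
  ultimately show ?case by simp
next
  case (Suc m A)
  interpret prob_space "expM n" by (rule prob_space_expM)
  have fA: "finite A" using Suc finite_P finite_subset by auto
  have ne: "A \<noteq> {}" using Suc by auto
  \<comment> \<open>For \<open>i \<noteq> j\<close> each of the two would have to arrive strictly
    before the other.\<close>
  have "i = j" if "T \<in> arrive_next (A - {i}) i" "T \<in> arrive_next (A - {j}) j" "i \<in> A" "j \<in> A" for i j T
    using that unfolding arrive_next_def by (metis (no_types, lifting) DiffI empty_iff insert_iff mem_Collect_eq not_less_iff_gr_or_eq)
  then have disj: "disjoint_family_on (\<lambda>i. arrive_next (A - {i}) i) A" by (auto simp: disjoint_family_on_def)
  have sets: "arrive_next (A - {i}) i \<in> sets (expM n)" if "i \<in> A" for i
    using that Suc by (intro sets_arrive(2)) auto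
  have "AE T in expM n. T \<in> arrive_first A \<longleftrightarrow> T \<in> (\<Union>i\<in>A. arrive_next (A - {i}) i)"
    using AE_no_ties AE_space by eventually_elim (use arrive_first_iff[OF Suc.prems ne] in auto)
  then have "measure (expM n) (arrive_first A) = measure (expM n) (\<Union>i\<in>A. arrive_next (A - {i}) i)"
    using sets_arrive(1)[OF Suc.prems] sets fA by (intro measure_eq_AE) auto
  also have "\<dots> = (\<Sum>i\<in>A. measure (expM n) (arrive_next (A - {i}) i))"
    using disj sets fA by (intro finite_measure_finite_Union) auto
  also have "\<dots> = (\<Sum>i\<in>A. pmf (swor w P m) (A - {i}) * (w i / (\<Sum>j\<in>P - (A - {i}). w j)))"
  proof (intro sum.cong refl)
    fix i assume i: "i \<in> A"
    have W: "w i / (\<Sum>j\<in>P - (A - {i}). w j) \<ge> 0" using i w_pos Suc.prems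
      by (intro divide_nonneg_nonneg sum_nonneg) (auto intro: less_imp_le)
    have "emeasure (expM n) (arrive_next (A - {i}) i)
       = ennreal (w i / (\<Sum>j\<in>P - (A - {i}). w j)) * emeasure (expM n) (arrive_first (A - {i}))"
      using i Suc.prems by (intro emeasure_arrive_next) auto
    then have "measure (expM n) (arrive_next (A - {i}) i)
       = (w i / (\<Sum>j\<in>P - (A - {i}). w j)) * measure (expM n) (arrive_first (A - {i}))"
      using W by (simp add: emeasure_eq_measure ennreal_mult'[symmetric] del: times_divide_eq_left)
    also have "measure (expM n) (arrive_first (A - {i})) = pmf (swor w P m) (A - {i})"
    proof -
      have "m = card (A - {i})" using i by (simp add: Suc.hyps(2)[symmetric])
      then show ?thesis using Suc(1)[of "A - {i}"] Suc.prems by auto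
    qed
    finally show "measure (expM n) (arrive_next (A - {i}) i) = pmf (swor w P m) (A - {i}) * (w i / (\<Sum>j\<in>P - (A - {i}). w j))"
      by simp
  qed
  also have "\<dots> = pmf (swor w P (card A)) A"
    using Suc.hyps(2) pmf_swor_Suc[OF finite_P Suc.prems, of m w] w_pos by simp
  finally show ?case .
qed

end

section \<open>Selecting the largest keys, and measurability of the sampler\<close>

lemma top_keys:
  assumes "finite Q" "m \<le> card Q"
  shows "top_keys m v Q \<subseteq> Q" "card (top_keys m v Q) = m"
    "\<And>a b. a \<in> top_keys m v Q \<Longrightarrow> b \<in> Q - top_keys m v Q \<Longrightarrow> v b \<le> v a"
proof -
  let ?xs = "sort_key (\<lambda>i. - v i) (sorted_list_of_set Q)"
  have set: "set ?xs = Q" and len: "length ?xs = card Q" and d: "distinct ?xs" using assms by auto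
  have tk: "top_keys m v Q = set (take m ?xs)" by (simp add: top_keys_def)
  show "top_keys m v Q \<subseteq> Q" using set set_take_subset unfolding tk by metis
  show "card (top_keys m v Q) = m" unfolding tk using d assms len by (subst distinct_card) auto
  fix a b assume a: "a \<in> top_keys m v Q" and b: "b \<in> Q - top_keys m v Q"
  have "sorted (map (\<lambda>i. - v i) ?xs)" by simp
  then have "sorted (map (\<lambda>i. - v i) (take m ?xs @ drop m ?xs))" by (simp only: append_take_drop_id)
  then have "\<forall>x\<in>set (take m ?xs). \<forall>y\<in>set (drop m ?xs). - v x \<le> - v y"
    by (simp only: map_append sorted_append) auto
  moreover have "b \<in> set (drop m ?xs)" using b set tk by (metis DiffE Un_iff append_take_drop_id set_append)
  ultimately show "v b \<le> v a" using a tk by fastforce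
qed

text \<open>Two distinct sets of equal size each have an element that the other lacks, and the two
  domination properties order these elements in contradictory ways. One strict side
  suffices.\<close>

lemma top_set_exchange:
  assumes "finite C" "card C = card B" "\<And>a b. a \<in> C \<Longrightarrow> b \<in> B - C \<Longrightarrow> (v b :: real) \<le> v a"
    "\<And>a b. a \<in> B \<Longrightarrow> b \<in> C - B \<Longrightarrow> v b < v a" "finite B"
  shows "C = B"
proof (rule ccontr)
  assume "C \<noteq> B"
  then have "\<not> C \<subseteq> B" "\<not> B \<subseteq> C" using assms card_subset_eq by metis+
  then obtain a b where "a \<in> C - B" "b \<in> B - C" by auto
  then show False using assms(3)[of a b] assms(4)[of b a] by auto
qed

text \<open>Sampling algorithms are piecewise constant in the exponentials with countably many pieces;
  unlike plain measurability, this property is closed under the composition below.\<close>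
definition countably_valued :: "'a measure \<Rightarrow> ('a \<Rightarrow> 'b) \<Rightarrow> bool" where
  "countably_valued M f \<longleftrightarrow> f \<in> M \<rightarrow>\<^sub>M count_space UNIV \<and> countable (f ` space M)"

lemma countably_valued_const [simp, intro]: "countably_valued M (\<lambda>_. c)"
  by (auto simp: countably_valued_def intro: countable_subset[of _ "{c}"])

lemma measurable_compose_countably_valued:
  assumes f: "countably_valued M f" and g: "\<And>y. (\<lambda>x. g y x) \<in> M \<rightarrow>\<^sub>M N"
  shows "(\<lambda>x. g (f x) x) \<in> M \<rightarrow>\<^sub>M N"
proof (rule measurable_compose_countable'[where I = "f ` space M"])
  show "f \<in> M \<rightarrow>\<^sub>M count_space (f ` space M)"
    using f by (auto simp: countably_valued_def measurable_def)
  show "countable (f ` space M)" using f by (simp add: countably_valued_def)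
qed (rule g)

lemma countably_valued_bind:
  assumes f: "countably_valued M f" and g: "\<And>y. countably_valued M (\<lambda>x. g y x)"
  shows "countably_valued M (\<lambda>x. g (f x) x)"
proof -
  have meas: "(\<lambda>x. g (f x) x) \<in> M \<rightarrow>\<^sub>M count_space UNIV"
    by (rule measurable_compose_countably_valued[OF f]) (use g in \<open>simp add: countably_valued_def\<close>)
  have "(\<lambda>x. g (f x) x) ` space M \<subseteq> (\<Union>y\<in>f ` space M. (\<lambda>x. g y x) ` space M)" by auto
  moreover have "countable (\<Union>y\<in>f ` space M. (\<lambda>x. g y x) ` space M)"
    using f g by (intro countable_UN) (simp_all add: countably_valued_def)
  ultimately have "countable ((\<lambda>x. g (f x) x) ` space M)"
    using countable_subset by blast
  with meas show ?thesis by (simp add: countably_valued_def)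
qed

lemma countably_valued_comp: "countably_valued M f \<Longrightarrow> countably_valued M (\<lambda>x. h (f x))"
  using countably_valued_bind[of M f "\<lambda>y _. h y"] by auto

lemma countably_valued_If:
  assumes "Measurable.pred M P" "countably_valued M f" "countably_valued M g"
  shows "countably_valued M (\<lambda>x. if P x then f x else g x)"
proof -
  have "countably_valued M P" using assms(1) by (simp add: countably_valued_def)
  moreover have "countably_valued M (\<lambda>x. if b then f x else g x)" for b using assms by (cases b) auto
  ultimately show ?thesis by (rule countably_valued_bind)
qed

text \<open>Insertion sort is a finite tree of comparisons of two keys, and each comparison is a
  measurable event.\<close>

lemma countably_valued_sort_key:
  fixes v :: "'a \<Rightarrow> nat \<Rightarrow> real"
  assumes v: "\<And>i. (\<lambda>x. v x i) \<in> borel_measurable M"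
  shows "countably_valued M (\<lambda>x. sort_key (v x) xs)"
proof (induction xs)
  case (Cons y xs)
  have ins: "countably_valued M (\<lambda>x. insort_key (v x) y ys)" for ys
  proof (induction ys)
    case (Cons z zs)
    have "Measurable.pred M (\<lambda>x. v x y \<le> v x z)" unfolding pred_def by (intro borel_measurable_le v)
    then have "countably_valued M (\<lambda>x. if v x y \<le> v x z then y # z # zs else z # insort_key (v x) y zs)"
      by (intro countably_valued_If countably_valued_const countably_valued_comp[OF Cons, of "(#) z"])
    then show ?case by simp
  qed auto
  show ?case using countably_valued_bind[OF Cons, of "\<lambda>ys x. insort_key (v x) y ys"] ins by simp
qed auto

section \<open>The distribution of the query\<close>

text \<open>Coordinates beyond \<open>n\<close> are constantly \<open>undefined\<close> on the
  product space. Covering them lets measurability be stated for states that mention arbitrary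
  indices.\<close>

lemma measurable_expM_component' [measurable]: "(\<lambda>T. T i) \<in> borel_measurable (expM n)"
proof (cases "i < n")
  case False
  then have "T i = undefined" if "T \<in> space (expM n)" for T
    using that by (auto simp: expM_def space_PiM PiE_iff extensional_def)
  then show ?thesis by (subst measurable_cong[where g = "\<lambda>_. undefined"]) auto
qed auto

context
  fixes M :: "'a measure" and v :: "'a \<Rightarrow> nat \<Rightarrow> real"
  assumes v: "\<And>i. (\<lambda>x. v x i) \<in> borel_measurable M"
begin

lemma countably_valued_min_key_elem: "countably_valued M (\<lambda>x. min_key_elem (v x) S)"
  unfolding min_key_elem_def by (rule countably_valued_comp[OF countably_valued_sort_key[OF v]])

lemma countably_valued_raw_insert: "countably_valued M (\<lambda>x. raw_insert s (v x) i S)"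
  unfolding raw_insert_def Let_def
  using countably_valued_comp[OF countably_valued_min_key_elem, of "\<lambda>m. insert i S - {m}" "insert i S"]
  by (cases "s < card (insert i S)") simp_all

lemma measurable_ukey:
  assumes "s \<ge> 1"
  shows "(\<lambda>x. ukey s (v x) S) \<in> borel_measurable M"
proof (cases "card S = s")
  case True
  then have S: "finite S" "S \<noteq> {}" using assms by (auto intro: card_ge_0_finite)
  have "Min (v x ` S) = v x (min_key_elem (v x) S)" for x
    using min_key_elem[OF S, where v = "v x"] S by (intro Min_eqI) auto
  moreover have "(\<lambda>x. v x (min_key_elem (v x) S)) \<in> borel_measurable M"
    by (rule measurable_compose_countably_valued[OF countably_valued_min_key_elem v])
  ultimately show ?thesis using True by (simp add: ukey_def)
next
  case False
  then show ?thesis by (simp add: ukey_def)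
qed

lemma countably_valued_ins_S:
  assumes "s \<ge> 1"
  shows "countably_valued M (\<lambda>x. ins_S k s (v x) i st)"
proof -
  let ?r = "rpar k s"
  define G where "G = (\<lambda>S' x. let u = ukey s (v x) S' in
    if u \<ge> 1 then
       (let j = \<lfloor>log ?r u\<rfloor> in
        if last_lvl st \<noteq> Some j then
          st\<lparr>coordS := S', last_lvl := Some j, site_tau := (\<lambda>_. ?r powr of_int j),
             msgs := msgs st + k\<rparr>
        else st\<lparr>coordS := S'\<rparr>)
     else st\<lparr>coordS := S', last_lvl := None\<rparr>)"
  have "countably_valued M (G S')" for S'
  proof -
    have u: "(\<lambda>x. ukey s (v x) S') \<in> borel_measurable M" by (rule measurable_ukey[OF assms])
    have "countably_valued M (\<lambda>x. \<lfloor>log ?r (ukey s (v x) S')\<rfloor>)"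
      using u by (auto simp: countably_valued_def)
    moreover have "Measurable.pred M (\<lambda>x. 1 \<le> ukey s (v x) S')"
      unfolding pred_def by (intro borel_measurable_le u) auto
    ultimately show ?thesis unfolding G_def Let_def
      by (intro countably_valued_If countably_valued_const
          countably_valued_comp[where h = "\<lambda>j. if last_lvl st \<noteq> Some j then
          st\<lparr>coordS := S', last_lvl := Some j, site_tau := (\<lambda>_. ?r powr of_int j),
             msgs := msgs st + k\<rparr>
        else st\<lparr>coordS := S'\<rparr>"])
  qed
  then have "countably_valued M (\<lambda>x. G (raw_insert s (v x) i (coordS st)) x)"
    by (rule countably_valued_bind[OF countably_valued_raw_insert])
  then show ?thesis by (simp add: ins_S_def G_def Let_def)
qed

lemma countably_valued_fold_ins_S:
  assumes "s \<ge> 1"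
  shows "countably_valued M (\<lambda>x. fold (ins_S k s (v x)) xs st)"
proof (induction xs arbitrary: st)
  case (Cons i xs)
  have "countably_valued M (\<lambda>x. fold (ins_S k s (v x)) xs (ins_S k s (v x) i st))"
    by (rule countably_valued_bind[OF countably_valued_ins_S[OF assms] Cons])
  then show ?case by simp
qed auto

lemma countably_valued_top_keys: "countably_valued M (\<lambda>x. top_keys m (v x) S)"
proof -
  have "countably_valued M (\<lambda>x. sort_key (\<lambda>i. - v x i) (sorted_list_of_set S))"
    using v by (intro countably_valued_sort_key) auto
  then show ?thesis unfolding top_keys_def
    by (rule countably_valued_comp[where h = "\<lambda>xs. set (take m xs)"])
qed

end

section \<open>The query as a function of the exponentials\<close>

context sampling_run
begin

lemma key_measurable: "(\<lambda>T. key T i) \<in> borel_measurable (expM n)"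
  unfolding key_def by measurable

lemma countably_valued_step: "countably_valued (expM n) (\<lambda>T. step k s w site T st i)"
proof -
  let ?v = "\<lambda>T m. w m / T m"
  have v: "(\<lambda>T. ?v T m) \<in> borel_measurable (expM n)" for m by measurable
  have fold: "countably_valued (expM n) (\<lambda>T. h (fold (ins_S k s (?v T)) xs st'))" for h :: "astate \<Rightarrow> astate" and xs st'
    by (rule countably_valued_comp[OF countably_valued_fold_ins_S[OF v s]])
  have ins: "countably_valued (expM n) (\<lambda>T. ins_S k s (?v T) i st')" for st'
    by (rule countably_valued_ins_S[OF v s])
  have 1: "Measurable.pred (expM n) (\<lambda>T. c < ?v T i)" for c
    unfolding pred_def by (intro borel_measurable_less v) auto
  have 2: "Measurable.pred (expM n) (\<lambda>T. ukey s (?v T) S < ?v T i)" for S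
    unfolding pred_def by (intro borel_measurable_less v measurable_ukey[OF v s])
  have 3: "Measurable.pred (expM n) (\<lambda>T. b)" for b by simp
  show ?thesis unfolding step_def Let_def
    by (intro countably_valued_If countably_valued_const ins 1 2 3
        fold[where h = "\<lambda>st2. st2\<lparr>coordD := (coordD st2)(_ := {}), coord_sat := (coord_sat st2)(_ := True),
               site_sat := (\<lambda>q' j'. if j' = _ then True else site_sat st2 q' j'),
               msgs := msgs st2 + k\<rparr>"])
qed

lemma countably_valued_state: "countably_valued (expM n) (\<lambda>T. state T t)"
proof (induction t)
  case 0
  then show ?case by (simp add: state_def run_def)
next
  case (Suc t)
  show ?case unfolding state_Suc by (rule countably_valued_bind[OF Suc countably_valued_step])
qed

lemma countably_valued_query: "countably_valued (expM n) (\<lambda>T. query s w T t (run k s w site T t))"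
proof -
  have "countably_valued (expM n) (\<lambda>T. query s w T t st)" for st
    unfolding query_def by (rule countably_valued_top_keys) measurable
  with countably_valued_state[of t] show ?thesis
    unfolding state_def by (rule countably_valued_bind)
qed

text \<open>The items missing from \<open>S\<close> and the buffers are the released ones outside
  \<open>S\<close>. If there is one, \<open>S\<close> holds \<open>s\<close> items with keys at
  least as large, so the missing items cannot change the answer. Without ties the set of top keys is
  unique, which gives the equivalence.\<close>

lemma query_eq_iff:
  assumes t: "t \<le> n" and pos: "\<And>i. i < n \<Longrightarrow> T i > 0" and inj: "inj_on (\<lambda>i. T i / w i) {..<t}"
  shows "query s w T t (run k s w site T t) = A
    \<longleftrightarrow> A \<subseteq> {..<t} \<and> card A = min t s \<and> (\<forall>a\<in>A. \<forall>b\<in>{..<t} - A. T a / w a < T b / w b)"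
proof -
  define st where "st = state T t"
  define Q where "Q = coordS st \<union> \<Union> (range (coordD st))"
  define C where "C = top_keys (min t s) (key T) Q"
  have C: "query s w T t (run k s w site T t) = C"
    by (simp add: query_def C_def Q_def st_def state_def key_def[abs_def])
  have key_less: "T a / w a < T b / w b \<longleftrightarrow> key T b < key T a" and key_eq: "T a / w a = T b / w b \<longleftrightarrow> key T b = key T a"
    if "a < t" "b < t" for a b
  proof -
    have "T a > 0" "T b > 0" "w a > 0" "w b > 0" using that t pos w[of a] w[of b] by auto
    then show "T a / w a < T b / w b \<longleftrightarrow> key T b < key T a" "T a / w a = T b / w b \<longleftrightarrow> key T b = key T a"
      by (auto simp: key_def field_simps)
  qed
  have inv: "run_inv T t st" unfolding st_def using run_inv_state[of t T] pos t by auto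
  then have top: "top_set s (key T) (released t) (coordS st)" by (simp add: run_inv_def sampler_inv_def)
  then have S: "coordS st \<subseteq> released t" "card (coordS st) = min s (card (released t))"
    "\<And>a b. a \<in> coordS st \<Longrightarrow> b \<in> released t - coordS st \<Longrightarrow> key T b \<le> key T a"
    by (auto simp: top_set_def)
  have D: "\<Union> (range (coordD st)) = {..<t} - released t"
    using inv by (fastforce simp: run_inv_def released_def lev_items_def split: if_splits)
  have Q: "Q \<subseteq> {..<t}" "{..<t} - Q = released t - coordS st"
    using S(1) by (auto simp: Q_def D released_def)
  then have fQ: "finite Q" using finite_subset by auto
  have cQ: "min t s \<le> card Q" and full_S: "b \<in> released t - coordS st \<Longrightarrow> card (coordS st) = s" for b
  proof -
    show *: "card (coordS st) = s" if "b \<in> released t - coordS st" for b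
    proof (rule ccontr)
      assume "card (coordS st) \<noteq> s"
      then have "card (coordS st) = card (released t)" using S(2) by auto
      then have "coordS st = released t" using S(1) card_subset_eq[of "released t" "coordS st"] by simp
      then show False using that by auto
    qed
    show "min t s \<le> card Q"
    proof (cases "released t - coordS st = {}")
      case True
      then have "Q = {..<t}" using Q by auto
      then show ?thesis by simp
    next
      case False
      then have "card (coordS st) = s" using * by auto
      then show ?thesis using card_mono[OF fQ, of "coordS st"] by (auto simp: Q_def)
    qed
  qed
  have Csub: "C \<subseteq> Q" and Ccard: "card C = min t s"
    and Ctop: "\<And>a b. a \<in> C \<Longrightarrow> b \<in> Q - C \<Longrightarrow> key T b \<le> key T a"
    unfolding C_def using top_keys[OF fQ cQ] by auto
  have fC: "finite C" using Csub fQ finite_subset by auto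
  have Ctop': "key T b \<le> key T a" if ab: "a \<in> C" "b \<in> {..<t} - C" for a b
  proof (cases "b \<in> Q")
    case False
    then have b: "b \<in> released t - coordS st" using ab Q by auto
    show ?thesis
    proof (rule ccontr)
      \<comment> \<open>All \<open>s\<close> items of \<open>S\<close> have keys of at least that of
        \<open>b\<close>, hence above that of \<open>a\<close>, so they are chosen before
        \<open>a\<close>. With \<open>a\<close> included, \<open>C\<close> would exceed
        \<open>s\<close> elements.\<close>
      assume "\<not> key T b \<le> key T a"
      then have *: "key T a < key T c" if "c \<in> coordS st" for c using S(3)[OF that b] by simp
      then have "coordS st \<subseteq> C - {a}" using Ctop[OF ab(1)] by (force simp: Q_def)
      then have "card (coordS st) \<le> card (C - {a})" using fC by (intro card_mono) auto
      also have "\<dots> < card C" using ab fC by (intro card_Diff1_less) auto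
      finally show False using full_S[OF b] Ccard by simp
    qed
  qed (use Ctop ab in auto)
  have C_strict: "T a / w a < T b / w b" if ab: "a \<in> C" "b \<in> {..<t} - C" for a b
  proof -
    have lt: "a < t" "b < t" using ab Csub Q by auto
    have "T a / w a \<noteq> T b / w b" using inj_onD[OF inj, of a b] lt ab by auto
    then show ?thesis using Ctop'[OF ab] lt by (auto simp: key_less key_eq)
  qed
  show ?thesis unfolding C
  proof
    assume "C = A"
    then show "A \<subseteq> {..<t} \<and> card A = min t s \<and> (\<forall>a\<in>A. \<forall>b\<in>{..<t} - A. T a / w a < T b / w b)"
      using Csub Q Ccard C_strict by auto
  next
    assume A: "A \<subseteq> {..<t} \<and> card A = min t s \<and> (\<forall>a\<in>A. \<forall>b\<in>{..<t} - A. T a / w a < T b / w b)"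
    show "C = A"
    proof (rule top_set_exchange[where v = "key T"])
      show "key T b \<le> key T a" if "a \<in> C" "b \<in> A - C" for a b using that A Ctop' by auto
      show "key T b < key T a" if "a \<in> A" "b \<in> C - A" for a b
      proof -
        have "b < t" "a < t" using that A Csub Q by auto
        then show ?thesis using that A by (auto simp: key_less[symmetric])
      qed
      show "finite A" using A finite_subset by auto
    qed (use fC A Ccard in auto)
  qed
qed

theorem query_distribution:
  assumes "t \<le> n"
  shows "measure (expM n) {T \<in> space (expM n). query s w T t (run k s w site T t) = A}
    = pmf (swor w {..<t} (min t s)) A"
proof -
  have wpos: "w i > 0" if "i < n" for i using w[OF that] by simp
  interpret R: race n w "{..<t}" using assms wpos by unfold_locales auto
  let ?E = "{T \<in> space (expM n). query s w T t (run k s w site T t) = A}"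
  have "(\<lambda>T. query s w T t (run k s w site T t)) -` {A} \<inter> space (expM n) \<in> sets (expM n)"
    using countably_valued_query[of t] by (intro measurable_sets[of _ _ "count_space UNIV"]) (auto simp: countably_valued_def)
  then have E: "?E \<in> sets (expM n)" by (simp add: vimage_def Int_def conj_commute)
  have AE: "AE T in expM n. T \<in> ?E \<longleftrightarrow> A \<subseteq> {..<t} \<and> card A = min t s \<and> T \<in> R.arrive_first A"
    using R.AE_no_ties AE_expM_pos[of n] AE_space
  proof eventually_elim
    case (elim T)
    then have "T b / w b > 0" if "b < t" for b using that wpos assms by auto
    then show ?case using query_eq_iff[of t T A] elim assms by (auto simp: R.no_ties_def R.arrive_first_def)
  qed
  show ?thesis
  proof (cases "A \<subseteq> {..<t} \<and> card A = min t s")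
    case True
    then have "measure (expM n) ?E = measure (expM n) (R.arrive_first A)"
      using AE E R.sets_arrive(1)[of A] by (intro measure_eq_AE) auto
    also have "\<dots> = pmf (swor w {..<t} (card A)) A" using True by (intro R.prob_arrive_first) auto
    finally show ?thesis using True by simp
  next
    case False
    then have "measure (expM n) ?E = measure (expM n) {}"
      using AE E by (intro measure_eq_AE) auto
    moreover have "A \<notin> set_pmf (swor w {..<t} (min t s))"
      using set_pmf_swor[of "{..<t}" "min t s" w] False wpos assms by auto
    ultimately show ?thesis by (simp add: set_pmf_iff)
  qed
qed

end

section \<open>The expected number of messages\<close>

lemma emeasure_Exp1_UNIV: "emeasure Exp1 UNIV = 1"
  using Exp1.M.emeasure_space_1 by simp

text \<open>The right-hand side is the tangent at \<open>1\<close> of the concave map sending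
  \<open>z\<close> to \<open>z powr p\<close>. It is obtained from convexity of \<open>exp\<close>
  along the segment from \<open>0\<close> to \<open>ln z\<close>.\<close>

lemma powr_le_affine:
  assumes "0 \<le> p" "p \<le> 1" "z > (0::real)"
  shows "z powr p \<le> 1 + p * (z - 1)"
proof -
  have "convex_on UNIV (exp :: real \<Rightarrow> real)" by (rule exp_convex)
  from convex_onD[OF this, of p 0 "ln z"] show ?thesis
    using assms by (simp add: powr_def algebra_simps)
qed

text \<open>Jensen's inequality for the \<open>p\<close>-th power of a random variable that is \<open>1\<close> with probability
  \<open>\<theta>\<close> and \<open>\<theta>\<close> otherwise, where \<open>\<theta> = exp (- B)\<close> and \<open>p = c / B\<close>.\<close>
lemma exp_mixture_le:
  assumes "0 \<le> c" "c \<le> B" "B > (0::real)"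
  shows "exp (- B) + (1 - exp (- B)) * exp (- c) \<le> exp (c / B * (ln 2 - B))"
proof -
  define \<theta> where "\<theta> = exp (- B)"
  define p where "p = c / B"
  define \<mu> where "\<mu> = \<theta> * (2 - \<theta>)"
  have \<theta>: "0 < \<theta>" "\<theta> < 1" using assms by (auto simp: \<theta>_def)
  have p: "0 \<le> p" "p \<le> 1" using assms by (auto simp: p_def)
  have \<mu>: "0 < \<mu>" "\<mu> \<le> 2 * \<theta>" using \<theta> by (auto simp: \<mu>_def)
  have 1: "(1 / \<mu>) powr p \<le> 1 + p * (1 / \<mu> - 1)" "(\<theta> / \<mu>) powr p \<le> 1 + p * (\<theta> / \<mu> - 1)"
    using powr_le_affine p \<mu> \<theta> by auto
  \<comment> \<open>Both values were divided by the mean \<open>\<mu>\<close>, so the average of the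
    tangent bounds is exactly \<open>1\<close>.\<close>
  have "\<theta> * (1 / \<mu>) powr p + (1 - \<theta>) * (\<theta> / \<mu>) powr p
      \<le> \<theta> * (1 + p * (1 / \<mu> - 1)) + (1 - \<theta>) * (1 + p * (\<theta> / \<mu> - 1))"
    using \<theta> 1 by (intro add_mono mult_left_mono) auto
  also have "\<dots> = 1 + p * ((\<theta> + (1 - \<theta>) * \<theta>) / \<mu> - 1)" using \<mu> by (simp add: field_simps)
  also have "\<theta> + (1 - \<theta>) * \<theta> = \<mu>" by (simp add: \<mu>_def algebra_simps)
  also have "1 + p * (\<mu> / \<mu> - 1) = 1" using \<mu> by simp
  finally have "(\<theta> + (1 - \<theta>) * \<theta> powr p) / \<mu> powr p \<le> 1"
    using \<theta> \<mu> by (simp add: powr_divide add_divide_distrib)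
  then have "\<theta> + (1 - \<theta>) * \<theta> powr p \<le> \<mu> powr p" using \<mu> by (simp add: divide_le_eq)
  also have "\<dots> \<le> (2 * \<theta>) powr p" using \<mu> p by (intro powr_mono2) auto
  also have "(2 * \<theta>) powr p = exp (c / B * (ln 2 - B))"
    using \<theta> by (simp add: powr_def ln_mult p_def \<theta>_def)
  also have "\<theta> powr p = exp (- c)" using assms by (simp add: powr_def \<theta>_def p_def)
  finally show ?thesis by (simp add: \<theta>_def)
qed

text \<open>From \<open>ln 2 \<le> 3 / 4\<close> the factor \<open>4 * ln 2 - 3 * B\<close> is
  negative, so \<open>s = 1\<close> is the worst case. The remaining
  \<open>16 * exp (- 3 * B)\<close> is relaxed to the inverse square that is summed later.\<close>

lemma exp_tail_le:
  assumes "B > 1" "s \<ge> (1::nat)"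
  shows "exp (real s * (4 * ln 2 - 3 * B)) \<le> 16 / (1 + B)^2"
proof -
  have "(2::real) \<le> exp (3 / 4)" using exp_lower_Taylor_quadratic[of "3 / 4 :: real"] by (simp add: power2_eq_square)
  then have ln2: "ln 2 \<le> (3 / 4 :: real)" using ln_mono[of 2 "exp (3 / 4 :: real)"] by simp
  have "real s * (4 * ln 2 - 3 * B) \<le> 1 * (4 * ln 2 - 3 * B)"
    using assms ln2 by (intro mult_right_mono_neg) auto
  then have "exp (real s * (4 * ln 2 - 3 * B)) \<le> exp (4 * ln 2 - 3 * B)" by simp
  also have "\<dots> = 16 / exp B ^ 3"
  proof -
    have "exp (4 * ln (2::real)) = 16" using exp_of_nat_mult[of 4 "ln 2 :: real"] by simp
    moreover have "exp (3 * B) = exp B ^ 3" using exp_of_nat_mult[of 3 B] by simp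
    ultimately show ?thesis by (simp add: exp_diff)
  qed
  also have "\<dots> \<le> 16 / (1 + B)^2"
  proof (intro divide_left_mono)
    have "(1 + B)^2 \<le> (1 + B)^3" using assms by (intro power_increasing) auto
    also have "\<dots> \<le> exp B ^ 3" using assms exp_ge_add_one_self[of B] by (intro power_mono) auto
    finally show "(1 + B)^2 \<le> exp B ^ 3" .
  qed (use assms in auto)
  finally show ?thesis .
qed

lemma nn_integral_expM_indep:
  assumes i: "i < n" and [measurable]: "g \<in> borel_measurable Exp1" "h \<in> borel_measurable (expM n)"
    and h: "\<And>T y. h (T(i := y)) = h T"
  shows "(\<integral>\<^sup>+T. g (T i) * h T \<partial>expM n) = (\<integral>\<^sup>+t. g t \<partial>Exp1) * (\<integral>\<^sup>+T. h T \<partial>expM n)"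
proof -
  let ?J = "{..<n} - {i}"
  have I: "insert i ?J = {..<n}" using i by auto
  have ex: "expM n = PiM (insert i ?J) (\<lambda>_. Exp1)" unfolding I expM_def ..
  have split: "(\<integral>\<^sup>+T. f T \<partial>expM n) = (\<integral>\<^sup>+x. \<integral>\<^sup>+y. f (x(i := y)) \<partial>Exp1 \<partial>PiM ?J (\<lambda>_. Exp1))"
    if "f \<in> borel_measurable (expM n)" for f
    using that unfolding ex by (intro Exp1.product_nn_integral_insert) simp_all
  have [measurable]: "(\<lambda>T. g (T i)) \<in> borel_measurable (expM n)"
    using measurable_compose[OF measurable_expM_component'[of i n], of g borel] assms(2) by simp
  have hm: "h \<in> borel_measurable (PiM ?J (\<lambda>_. Exp1))"
  proof -
    \<comment> \<open>Any fixed value in coordinate \<open>i\<close> would do, as \<open>h\<close>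
      ignores it; \<open>0\<close> embeds the smaller product into the full one.\<close>
    have "(\<lambda>x. x(i := 0)) \<in> PiM ?J (\<lambda>_. Exp1) \<rightarrow>\<^sub>M expM n"
      unfolding ex by (intro measurable_fun_upd[of _ ?J]) auto
    from measurable_compose[OF this assms(3)] show ?thesis by (simp add: h)
  qed
  have "(\<integral>\<^sup>+T. g (T i) * h T \<partial>expM n) = (\<integral>\<^sup>+x. (\<integral>\<^sup>+y. g y \<partial>Exp1) * h x \<partial>PiM ?J (\<lambda>_. Exp1))"
    by (subst split) (auto simp: h nn_integral_multc intro!: nn_integral_cong)
  also have "\<dots> = (\<integral>\<^sup>+t. g t \<partial>Exp1) * (\<integral>\<^sup>+x. h x \<partial>PiM ?J (\<lambda>_. Exp1))"
    using hm by (rule nn_integral_cmult)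
  also have "(\<integral>\<^sup>+x. h x \<partial>PiM ?J (\<lambda>_. Exp1)) = (\<integral>\<^sup>+T. h T \<partial>expM n)"
    by (subst split) (simp_all add: h emeasure_Exp1_UNIV)
  finally show ?thesis .
qed

lemma nn_integral_Exp1_step:
  assumes "c \<ge> 0" "0 \<le> \<theta>" "\<theta> \<le> 1"
  shows "(\<integral>\<^sup>+t. ennreal (if t \<le> c then \<theta> else 1) \<partial>Exp1) = ennreal (\<theta> + (1 - \<theta>) * exp (- c))"
proof -
  have "(\<integral>\<^sup>+t. ennreal (if t \<le> c then \<theta> else 1) \<partial>Exp1)
      = (\<integral>\<^sup>+t. ennreal \<theta> + ennreal (1 - \<theta>) * indicator {c<..} t \<partial>Exp1)"
    using assms by (intro nn_integral_cong) (auto simp: ennreal_plus[symmetric] simp del: ennreal_plus)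
  also have "\<dots> = ennreal \<theta> + ennreal (1 - \<theta>) * emeasure Exp1 {c<..}"
    by (subst nn_integral_add) (auto simp: nn_integral_cmult_indicator emeasure_Exp1_UNIV)
  finally show ?thesis using assms
    by (simp add: emeasure_Exp1_greaterThan ennreal_mult[symmetric] ennreal_plus[symmetric] del: ennreal_plus)
qed

text \<open>A key of at least \<open>c\<close> means that the clock rings by time
  \<open>a / c\<close>, which has probability \<open>1 - exp (- (a / c))\<close>. The convention
  \<open>a / 0 = 0\<close> does no harm because \<open>c\<close> is positive.\<close>

lemma nn_integral_key_ge:
  assumes "c > 0" "a > 0"
  shows "(\<integral>\<^sup>+t. (if a / t \<ge> c then 1 else 0) \<partial>Exp1) \<le> ennreal (a / c)"
proof -
  have "(\<integral>\<^sup>+t. (if a / t \<ge> c then 1 else 0) \<partial>Exp1) \<le> (\<integral>\<^sup>+t. ennreal (if t \<le> a / c then 1 else 0) \<partial>Exp1)"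
  proof (intro nn_integral_mono)
    fix t :: real
    have "t \<le> a / c" if "a / t \<ge> c"
    proof (cases "t > 0")
      case False
      then have "a / t \<le> 0" using assms by (simp add: divide_nonneg_nonpos)
      then show ?thesis using that assms by linarith
    qed (use that assms in \<open>simp add: field_simps\<close>)
    then show "(if a / t \<ge> c then 1 else 0) \<le> ennreal (if t \<le> a / c then 1 else 0)" by auto
  qed
  also have "\<dots> = (\<integral>\<^sup>+t. indicator (space Exp1 - {a / c<..}) t \<partial>Exp1)"
    by (intro nn_integral_cong) (auto simp: indicator_def)
  also have "\<dots> = emeasure Exp1 (space Exp1 - {a / c<..})" by (rule nn_integral_indicator) simp
  also have "\<dots> = 1 - ennreal (exp (- (a / c)))"
    using assms by (subst emeasure_compl) (auto simp: emeasure_Exp1_greaterThan emeasure_Exp1_UNIV)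
  also have "\<dots> = ennreal (1 - exp (- (a / c)))" by (simp add: ennreal_minus flip: ennreal_1)
  also have "\<dots> \<le> ennreal (a / c)" using exp_ge_add_one_self[of "- (a / c)"] by (intro ennreal_leI) linarith
  finally show ?thesis .
qed

section \<open>Released weight and the lower tail of the threshold\<close>

context sampling_run
begin

lemma w_pos: "i < n \<Longrightarrow> w i > 0" using w[of i] by simp

lemma lev_bounds:
  assumes "i < n"
  shows "r ^ lev i \<le> w i" "w i < r ^ Suc (lev i)"
proof -
  have r1: "r > 1" using r by simp
  have "log r (w i) \<ge> 0" using w[OF assms] r1 by simp
  then have l: "real (lev i) \<le> log r (w i)" "log r (w i) < real (Suc (lev i))"
    by (auto simp: lev_def level_def) linarith+
  have "r powr real (lev i) \<le> w i" using l r1 w_pos[OF assms] by (simp add: le_log_iff)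
  then show "r ^ lev i \<le> w i" using r1 by (simp add: powr_realpow)
  have "w i < r powr real (Suc (lev i))" using l r1 w_pos[OF assms] by (simp add: log_less_iff)
  then show "w i < r ^ Suc (lev i)" using r1 by (simp only: powr_realpow)
qed

definition released_weight :: "nat \<Rightarrow> real" where
  "released_weight t = (\<Sum>a\<in>released t. w a)"

lemma released_less: "a \<in> released t \<Longrightarrow> a < t" by (simp add: released_def)

lemma released_weight_nonneg: "t \<le> n \<Longrightarrow> released_weight t \<ge> 0"
  unfolding released_weight_def by (intro sum_nonneg) (auto dest!: released_less intro!: less_imp_le[OF w_pos])

text \<open>Explains the capacity \<open>4 * r * s\<close>. The factor \<open>r\<close> lifts the
  lower end \<open>r ^ j\<close> of the level to its upper end, so that the released weight is
  compared with the heaviest possible item of the level; \<open>4 * s\<close> is the margin used by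
  Chernoff's bound.\<close>

lemma full_released_weight:
  assumes "full t j" "t \<le> n"
  shows "4 * real s * r ^ Suc j \<le> released_weight t"
proof -
  have "4 * real s * r ^ Suc j = 4 * r * real s * r ^ j" by simp
  also have "\<dots> \<le> real (card (lev_items t j)) * r ^ j"
    using assms(1) r by (intro mult_right_mono) (auto simp: full_def)
  also have "\<dots> = (\<Sum>a\<in>lev_items t j. r ^ j)" by simp
  also have "\<dots> \<le> (\<Sum>a\<in>lev_items t j. w a)"
    using assms(2) lev_bounds(1) by (intro sum_mono) (auto simp: lev_items_def)
  also have "\<dots> \<le> released_weight t" unfolding released_weight_def
    using assms w_pos by (intro sum_mono2) (auto simp: lev_items_def released_def intro!: less_imp_le[OF w_pos])
  finally show ?thesis .
qed

text \<open>The level buffers guarantee that no item is heavy compared with the released weight.\<close>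
lemma weight_le_released:
  assumes "full t (lev i)" "t \<le> n" "i < n"
  shows "4 * real s * w i \<le> released_weight t"
proof -
  have "4 * real s * w i \<le> 4 * real s * r ^ Suc (lev i)"
    using lev_bounds(2)[OF assms(3)] by (intro mult_left_mono) auto
  then show ?thesis using full_released_weight[OF assms(1,2)] by simp
qed

definition keys_above :: "(nat \<Rightarrow> real) \<Rightarrow> nat \<Rightarrow> real \<Rightarrow> nat" where
  "keys_above T t x = card {a \<in> released t. key T a \<ge> x}"

lemma keys_above_less_measurable [measurable]: "Measurable.pred (expM n) (\<lambda>T. keys_above T t x < s)"
proof -
  have "real (keys_above T t x) = (\<Sum>a\<in>released t. if key T a \<ge> x then 1 else 0)" for T
    unfolding keys_above_def by (subst sum.inter_filter[symmetric]) simp_all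
  then have eq: "keys_above T t x < s \<longleftrightarrow> (\<Sum>a\<in>released t. if key T a \<ge> x then 1 else 0) < real s" for T
    by (metis of_nat_less_iff)
  have [measurable]: "Measurable.pred (expM n) (\<lambda>T. x \<le> key T a)" for a
    unfolding pred_def by (intro borel_measurable_le key_measurable) auto
  show ?thesis unfolding eq by measurable
qed

definition below_prob :: "nat \<Rightarrow> real \<Rightarrow> ennreal" where
  "below_prob t x = (\<integral>\<^sup>+T. (if keys_above T t x < s then 1 else 0) \<partial>expM n)"

text \<open>Chernoff's bound with parameter \<open>\<theta> = exp (- B)\<close>: the indicator of fewer than \<open>s\<close> keys above
  \<open>x\<close> is at most \<open>\<theta> powr (keys_above T t x - s)\<close>.\<close>
lemma chernoff_keys_above:
  assumes t: "t \<le> n" and x: "x > 0" and B: "B = released_weight t / (4 * real s * x)" "B > 0"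
  shows "below_prob t x \<le> ennreal (exp (real s * (4 * ln 2 - 3 * B)))"
proof -
  define \<theta> where "\<theta> = exp (- B)"
  have \<theta>: "0 < \<theta>" "\<theta> < 1" using B(2) by (auto simp: \<theta>_def)
  define f where "f = (\<lambda>a u. if a \<in> released t then ennreal (if u \<le> w a / x then \<theta> else 1) else 1)"
  have [measurable]: "f a \<in> borel_measurable Exp1" for a unfolding f_def by measurable
  have inv: "ennreal (exp (real s * B)) * ennreal (\<theta> ^ s) = 1"
  proof -
    have "exp (real s * B) * \<theta> ^ s = 1" by (simp add: \<theta>_def exp_of_nat_mult[symmetric] exp_add[symmetric])
    then show ?thesis using \<theta> by (simp add: ennreal_mult[symmetric])
  qed
  have "below_prob t x \<le> (\<integral>\<^sup>+T. ennreal (exp (real s * B)) * (\<Prod>a<n. f a (T a)) \<partial>expM n)"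
    unfolding below_prob_def
  proof (rule nn_integral_mono_AE)
    show "AE T in expM n. (if keys_above T t x < s then 1 else 0) \<le> ennreal (exp (real s * B)) * (\<Prod>a<n. f a (T a))"
      using AE_expM_pos
    proof eventually_elim
      case (elim T)
      have iff: "T a \<le> w a / x \<longleftrightarrow> key T a \<ge> x" if "a \<in> released t" for a
      proof -
        have "T a > 0" using elim released_less[OF that] t by simp
        then show ?thesis using x by (simp add: key_def field_simps)
      qed
      have "(\<Prod>a<n. f a (T a)) = (\<Prod>a\<in>released t. f a (T a))"
        using t by (intro prod.mono_neutral_right) (auto simp: f_def dest: released_less)
      also have "\<dots> = (\<Prod>a\<in>released t. if key T a \<ge> x then ennreal \<theta> else 1)"
        by (intro prod.cong refl) (auto simp: f_def iff)
      also have "\<dots> = ennreal \<theta> ^ keys_above T t x"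
        by (subst prod.inter_filter[symmetric]) (simp_all add: keys_above_def)
      finally have p: "(\<Prod>a<n. f a (T a)) = ennreal (\<theta> ^ keys_above T t x)"
        using \<theta> by (simp add: ennreal_power)
      show ?case
      proof (cases "keys_above T t x < s")
        case True
        then have "\<theta> ^ s \<le> \<theta> ^ keys_above T t x" using \<theta> by (intro power_decreasing) auto
        then have "ennreal (exp (real s * B)) * ennreal (\<theta> ^ s) \<le> ennreal (exp (real s * B)) * ennreal (\<theta> ^ keys_above T t x)"
          by (intro mult_left_mono ennreal_leI) auto
        then show ?thesis using True by (simp add: p inv)
      qed simp
    qed
  qed
  also have "\<dots> = ennreal (exp (real s * B)) * (\<integral>\<^sup>+T. (\<Prod>a\<in>{..<n}. f a (T a)) \<partial>expM n)"
    by (intro nn_integral_cmult borel_measurable_prod_ennreal)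
       (rule measurable_compose[OF measurable_expM_component'], simp add: f_def)
  also have "(\<integral>\<^sup>+T. (\<Prod>a\<in>{..<n}. f a (T a)) \<partial>expM n) = (\<Prod>a\<in>{..<n}. \<integral>\<^sup>+u. f a u \<partial>Exp1)"
    unfolding expM_def by (intro Exp1.product_nn_integral_prod) auto
  also have "\<dots> \<le> (\<Prod>a\<in>{..<n}. if a \<in> released t then ennreal (exp (w a / x / B * (ln 2 - B))) else 1)"
  proof (intro prod_mono_ennreal)
    fix a assume a: "a \<in> {..<n}"
    show "(\<integral>\<^sup>+u. f a u \<partial>Exp1) \<le> (if a \<in> released t then ennreal (exp (w a / x / B * (ln 2 - B))) else 1)"
    proof (cases "a \<in> released t")
      case True
      \<comment> \<open>Saturation enters here: it makes the exponent
        \<open>p = (w a / x) / B\<close> in the mixture bound at most \<open>1\<close>.\<close>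
      have "4 * real s * w a \<le> released_weight t"
        using True a t by (intro weight_le_released) (auto simp: released_def)
      then have "w a / x \<le> B" using x s by (simp add: B(1) field_simps)
      moreover have "0 \<le> w a / x" using w_pos[of a] a x by (simp add: less_imp_le)
      ultimately have "\<theta> + (1 - \<theta>) * exp (- (w a / x)) \<le> exp (w a / x / B * (ln 2 - B))"
        unfolding \<theta>_def using B(2) by (intro exp_mixture_le)
      then show ?thesis using True nn_integral_Exp1_step[of "w a / x" \<theta>] \<theta> \<open>0 \<le> w a / x\<close>
        by (simp add: f_def ennreal_leI del: ennreal_plus)
    next
      case False
      then show ?thesis by (simp add: f_def emeasure_Exp1_UNIV)
    qed
  qed
  also have "(\<Prod>a\<in>{..<n}. if a \<in> released t then ennreal (exp (w a / x / B * (ln 2 - B))) else 1)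
      = (\<Prod>a\<in>released t. ennreal (exp (w a / x / B * (ln 2 - B))))"
    using t by (intro prod.mono_neutral_cong_right) (auto dest: released_less)
  also have "\<dots> = ennreal (exp (\<Sum>a\<in>released t. w a / x / B * (ln 2 - B)))"
    by (simp add: prod_ennreal exp_sum)
  also have "(\<Sum>a\<in>released t. w a / x / B * (ln 2 - B)) = released_weight t / x / B * (ln 2 - B)"
    by (simp add: released_weight_def sum_divide_distrib sum_distrib_right)
  \<comment> \<open>The exponents \<open>p\<close> add up to \<open>4 * s\<close> however the weight
    is distributed. After the price \<open>exp (s * B)\<close> for the event is paid,
    \<open>3 * s * B\<close> remains in the exponent.\<close>
  also have "released_weight t / x / B = 4 * real s"
  proof -
    have "released_weight t = B * (4 * real s * x)" using B(1) x s by simp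
    then show ?thesis using B(2) x by simp
  qed
  also have "ennreal (exp (real s * B)) * ennreal (exp (4 * real s * (ln 2 - B))) = ennreal (exp (real s * (4 * ln 2 - 3 * B)))"
    by (simp add: ennreal_mult[symmetric] exp_add[symmetric] algebra_simps)
  finally show ?thesis by (simp add: mult_left_mono)
qed

lemma below_prob_le_1: "below_prob t x \<le> 1"
proof -
  interpret P: prob_space "expM n" by (rule prob_space_expM)
  have "below_prob t x \<le> (\<integral>\<^sup>+T. 1 \<partial>expM n)" unfolding below_prob_def by (intro nn_integral_mono) auto
  then show ?thesis by (simp add: P.emeasure_space_1)
qed

lemma below_prob_le:
  assumes "t \<le> n" "x > 0"
  shows "below_prob t x \<le> ennreal (16 / (1 + released_weight t / (4 * real s * x))^2)"
proof -
  define B where "B = released_weight t / (4 * real s * x)"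
  have "B \<ge> 0" using released_weight_nonneg assms by (simp add: B_def)
  show ?thesis
  proof (cases "B > 1")
    case True
    have "below_prob t x \<le> ennreal (exp (real s * (4 * ln 2 - 3 * B)))"
      using chernoff_keys_above[OF assms B_def] True by simp
    also have "\<dots> \<le> ennreal (16 / (1 + B)^2)" using exp_tail_le[OF True s] by (rule ennreal_leI)
    finally show ?thesis unfolding B_def .
  next
    case False
    \<comment> \<open>For \<open>B \<le> 1\<close> the claimed bound is at least \<open>4\<close>,
      hence trivial for a probability.\<close>
    have "(1 + B)^2 \<le> 2^2" using False \<open>B \<ge> 0\<close> by (intro power_mono) auto
    moreover have "(1 + B)^2 > 0" using \<open>B \<ge> 0\<close> by simp
    ultimately have "1 \<le> 16 / (1 + B)^2" by (subst pos_le_divide_eq) auto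
    then have "1 \<le> ennreal (16 / (1 + B)^2)" by (metis ennreal_1 ennreal_leI)
    then show ?thesis using below_prob_le_1[of t x] unfolding B_def by (rule order_trans[rotated])
  qed
qed

definition regular :: "nat \<Rightarrow> nat set" where "regular t = {i. i < t \<and> full i (lev i)}"

lemma finite_regular [simp]: "finite (regular t)" by (simp add: regular_def)

text \<open>A Riemann sum of \<open>1 / (a + y)^2\<close>, bounded by telescoping.\<close>
lemma sum_regular_le:
  assumes a: "a > 0" and "t \<le> n"
  shows "(\<Sum>i\<in>regular t. w i / (a + released_weight i)^2) \<le> 5 / 4 * (1 / a - 1 / (a + released_weight t))"
  using assms(2)
proof (induction t)
  case 0
  then show ?case by (simp add: regular_def released_weight_def released_def)
next
  case (Suc t)
  have IH: "(\<Sum>i\<in>regular t. w i / (a + released_weight i)^2) \<le> 5 / 4 * (1 / a - 1 / (a + released_weight t))"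
    using Suc by simp
  let ?W = "released_weight t"
  have W: "?W \<ge> 0" using released_weight_nonneg Suc by simp
  have sub: "released t \<subseteq> released (Suc t)" using full_mono by (fastforce simp: released_def)
  have nn: "b \<in> released (Suc t) \<Longrightarrow> 0 \<le> w b" for b using w_pos[of b] Suc.prems released_less[of b "Suc t"] by simp
  show ?case
  proof (cases "full t (lev t)")
    case False
    \<comment> \<open>An early item contributes no term. It may release a whole level at once, but
      this only enlarges the right-hand side.\<close>
    have "?W \<le> released_weight (Suc t)" unfolding released_weight_def using sub nn by (intro sum_mono2) auto
    then have "1 / (a + released_weight (Suc t)) \<le> 1 / (a + ?W)" using W a by (intro divide_left_mono) auto
    moreover have "regular (Suc t) = regular t" using False by (auto simp: regular_def less_Suc_eq)
    ultimately show ?thesis using IH by simp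
  next
    case True
    have reg: "regular (Suc t) = insert t (regular t)" "t \<notin> regular t" using True by (auto simp: regular_def less_Suc_eq)
    have tn: "t < n" using Suc.prems by simp
    have "t \<in> released (Suc t)" using True full_mono by (auto simp: released_def)
    then have "insert t (released t) \<subseteq> released (Suc t)" using sub by auto
    then have "(\<Sum>b\<in>insert t (released t). w b) \<le> released_weight (Suc t)"
      unfolding released_weight_def using nn by (intro sum_mono2) auto
    moreover have "t \<notin> released t" by (simp add: released_def)
    ultimately have W': "?W + w t \<le> released_weight (Suc t)" by (simp add: released_weight_def)
    \<comment> \<open>A regular item adds at most a quarter of the weight already released. So the
      denominators \<open>p\<close> and \<open>q\<close> differ by a factor of at most
      \<open>5 / 4\<close>, the price of comparing \<open>w t / p^2\<close> with the telescoping
      \<open>w t / (p * q)\<close>.\<close>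
    have "4 * w t \<le> 4 * real s * w t" using s w_pos[OF tn] by simp
    also have "\<dots> \<le> ?W" using weight_le_released[OF True] tn by simp
    finally have le: "a + ?W + w t \<le> 5 / 4 * (a + ?W)" using a by simp
    define p q where "p = a + ?W" and "q = a + ?W + w t"
    have pq: "p > 0" "q > 0" "q \<le> 5 / 4 * p" "w t = q - p" "p < q" using a W le w_pos[OF tn] by (auto simp: p_def q_def)
    have "w t / p^2 \<le> 5 / 4 * (1 / p - 1 / q)"
    proof -
      have "w t * q \<le> w t * (5 / 4 * p)" using pq w_pos[OF tn] by (intro mult_left_mono) auto
      then have "w t / p^2 \<le> 5 / 4 * (w t / (p * q))" using pq(1,2) by (simp add: field_simps power2_eq_square)
      also have "w t / (p * q) = 1 / p - 1 / q" using pq by (simp add: field_simps)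
      finally show ?thesis .
    qed
    moreover have "1 / (a + released_weight (Suc t)) \<le> 1 / q"
      using W' pq(2) by (intro divide_left_mono) (auto simp: q_def)
    ultimately show ?thesis using IH reg by (simp add: p_def)
  qed
qed

text \<open>With \<open>a = 4 * s * x\<close> the summand is
  \<open>16 * a^2 * w i / (a + V)^2\<close>, \<open>V\<close> being the released weight, and the sum
  is at most \<open>16 * a^2 * (5 / 4) / a = 20 * a = 80 * s * x\<close>.\<close>

lemma sum_below_prob_le:
  assumes "x > 0"
  shows "(\<Sum>i\<in>regular n. ennreal (w i) * below_prob i x) \<le> ennreal (80 * real s * x)"
proof -
  define a where "a = 4 * real s * x"
  have a: "a > 0" using assms s by (simp add: a_def)
  have "(\<Sum>i\<in>regular n. ennreal (w i) * below_prob i x) \<le> (\<Sum>i\<in>regular n. ennreal (16 * a^2 * (w i / (a + released_weight i)^2)))"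
  proof (intro sum_mono)
    fix i assume "i \<in> regular n"
    then have i: "i < n" by (simp add: regular_def)
    have "a + released_weight i > 0" using a released_weight_nonneg[of i] i by simp
    moreover have "1 + released_weight i / a = (a + released_weight i) / a" using a by (simp add: field_simps)
    ultimately have "16 / (1 + released_weight i / a)^2 = 16 * a^2 / (a + released_weight i)^2"
      using a by (simp add: power_divide)
    then have "below_prob i x \<le> ennreal (16 * a^2 / (a + released_weight i)^2)"
      using below_prob_le[of i x] i assms by (simp add: a_def)
    then have "ennreal (w i) * below_prob i x \<le> ennreal (w i) * ennreal (16 * a^2 / (a + released_weight i)^2)"
      by (intro mult_left_mono) auto
    also have "\<dots> = ennreal (16 * a^2 * (w i / (a + released_weight i)^2))"
      using w_pos[OF i] by (subst ennreal_mult[symmetric]) (auto simp: mult_ac)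
    finally show "ennreal (w i) * below_prob i x \<le> ennreal (16 * a^2 * (w i / (a + released_weight i)^2))" .
  qed
  also have "\<dots> = ennreal (\<Sum>i\<in>regular n. 16 * a^2 * (w i / (a + released_weight i)^2))"
  proof (intro sum_ennreal)
    fix i assume "i \<in> regular n"
    then have "w i > 0" using w_pos by (simp add: regular_def)
    then show "0 \<le> 16 * a^2 * (w i / (a + released_weight i)^2)" by simp
  qed
  also have "\<dots> \<le> ennreal (80 * real s * x)"
  proof (intro ennreal_leI)
    have "1 / (a + released_weight n) \<ge> 0" using a released_weight_nonneg[of n] by simp
    then have "1 / a - 1 / (a + released_weight n) \<le> 1 / a" by simp
    then have "5 / 4 * (1 / a - 1 / (a + released_weight n)) \<le> 5 / 4 * (1 / a)" by (rule mult_left_mono) simp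
    with sum_regular_le[OF a, of n] have "(\<Sum>i\<in>regular n. w i / (a + released_weight i)^2) \<le> 5 / 4 * (1 / a)"
      by (meson order_refl order_trans)
    then have "16 * a^2 * (\<Sum>i\<in>regular n. w i / (a + released_weight i)^2) \<le> 16 * a^2 * (5 / 4 * (1 / a))"
      by (intro mult_left_mono) auto
    also have "\<dots> = 80 * real s * x" using a by (simp add: a_def power2_eq_square)
    finally show "(\<Sum>i\<in>regular n. 16 * a^2 * (w i / (a + released_weight i)^2)) \<le> 80 * real s * x"
      by (simp add: sum_distrib_left)
  qed
  finally show ?thesis .
qed

end

section \<open>Expected cost of regular items and of threshold broadcasts\<close>

context sampling_run
begin

definition W :: real where "W = (\<Sum>i<n. w i)"

text \<open>The number of threshold values, spaced by factors \<open>r\<close>, up to the typical size \<open>W / s\<close> of the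
  \<open>s\<close>-th largest key.\<close>
definition epochs :: nat where "epochs = nat \<lceil>log r (W / real s)\<rceil>"

text \<open>The summands cover a site threshold of \<open>0\<close>, of \<open>r ^ j\<close> with
  \<open>j < epochs\<close>, and of at least \<open>r ^ epochs\<close>. In the last range the size
  of the key alone is rare enough, and the state of \<open>S\<close> is ignored.\<close>

definition reg_bound :: "(nat \<Rightarrow> real) \<Rightarrow> nat \<Rightarrow> ennreal" where
  "reg_bound T i = (if keys_above T i 1 < s then 1 else 0)
     + (\<Sum>j<epochs. (if key T i \<ge> r ^ j then 1 else 0) * (if keys_above T i (r ^ Suc j) < s then 1 else 0))
     + (if key T i \<ge> r ^ epochs then 1 else 0)"

text \<open>The first \<open>epochs\<close> powers are granted. A further power
  \<open>r ^ (epochs + j)\<close> is reached only if \<open>s\<close> keys attain it, and division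
  by \<open>s\<close> is Markov's inequality applied to the number of such keys.\<close>

definition level_bound :: "(nat \<Rightarrow> real) \<Rightarrow> ennreal" where
  "level_bound T = of_nat epochs + (\<Sum>j. (\<Sum>a<n. (if key T a \<ge> r ^ (epochs + j) then 1 else 0)) / of_nat s)"

lemma thr_ge_iff:
  assumes "\<And>i. i < n \<Longrightarrow> T i > 0" "t \<le> n" "x > 0"
  shows "thr T t \<ge> x \<longleftrightarrow> s \<le> keys_above T t x"
proof -
  have "run_inv T t (state T t)" using assms run_inv_state[of t T] by auto
  then have "top_set s (key T) (released t) (coordS (state T t))" by (simp add: run_inv_def sampler_inv_def)
  from ukey_ge_iff[OF this _ s assms(3)] show ?thesis by (simp add: thr_def keys_above_def)
qed

lemma sent_le_reg_bound:
  assumes pos: "\<And>i. i < n \<Longrightarrow> T i > 0"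
  shows "of_nat (card (sent T n)) \<le> (\<Sum>i\<in>regular n. reg_bound T i)"
proof -
  have "of_nat (card (sent T n)) = (\<Sum>i\<in>sent T n. (1::ennreal))" by simp
  also have "\<dots> \<le> (\<Sum>i\<in>sent T n. reg_bound T i)"
  proof (intro sum_mono)
    fix i assume i: "i \<in> sent T n"
    then have "i < n" and key: "key T i > site_tau (state T i) (site i)" by (auto simp: sent_def)
    have inv: "run_inv T i (state T i)" using \<open>i < n\<close> pos run_inv_state[of i T] by auto
    define u where "u = thr T i"
    have thr: "u \<ge> x \<longleftrightarrow> s \<le> keys_above T i x" if "x > 0" for x
      using thr_ge_iff[OF pos _ that] \<open>i < n\<close> by (auto simp: u_def)
    have r1: "r > 1" using r by simp
    show "1 \<le> reg_bound T i"
    proof (cases "u \<ge> 1")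
      case False
      then have "keys_above T i 1 < s" using thr[of 1] by auto
      then show ?thesis by (simp add: reg_bound_def add.assoc)
    next
      case True
      define j where "j = nat \<lfloor>log r u\<rfloor>"
      have l: "\<lfloor>log r u\<rfloor> = int j" using True r1 by (simp add: j_def)
      have "site_tau (state T i) (site i) = r powr \<lfloor>log r u\<rfloor>"
        using inv True by (auto simp: run_inv_def sampler_inv_def Let_def u_def thr_def r_def)
      then have tau: "key T i > r ^ j" using key r1 by (simp add: l powr_realpow)
      have "log r u < real (Suc j)" using l by linarith
      then have "u < r powr real (Suc j)" using True r1 by (simp add: log_less_iff)
      then have "u < r ^ Suc j" using r1 by (simp only: powr_realpow)
      then have above: "keys_above T i (r ^ Suc j) < s" using thr[of "r ^ Suc j"] r1 by auto
      show ?thesis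
      proof (cases "j < epochs")
        case True
        let ?g = "\<lambda>j. (if key T i \<ge> r ^ j then 1 else 0) * (if keys_above T i (r ^ Suc j) < s then 1 else (0::ennreal))"
        have "?g j \<le> (\<Sum>j<epochs. ?g j)" using True by (intro member_le_sum) auto
        moreover have "?g j = 1" using tau above by auto
        ultimately have "1 \<le> (\<Sum>j<epochs. ?g j)" by simp
        then show ?thesis unfolding reg_bound_def by (meson add_increasing add_increasing2 zero_le)
      next
        case False
        then have "r ^ epochs \<le> r ^ j" using r1 by (intro power_increasing) auto
        then have "r ^ epochs \<le> key T i" using tau by simp
        then show ?thesis unfolding reg_bound_def by (simp add: add_increasing)
      qed
    qed
  qed
  also have "\<dots> \<le> (\<Sum>i\<in>regular n. reg_bound T i)" by (intro sum_mono2) (auto simp: sent_def regular_def)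
  finally show ?thesis .
qed

lemma levels_le_level_bound:
  assumes pos: "\<And>i. i < n \<Longrightarrow> T i > 0"
  shows "of_nat (levels_below r (thr T n)) \<le> level_bound T"
proof -
  define N where "N = levels_below r (thr T n)"
  define g where "g = (\<lambda>j. (\<Sum>a<n. (if key T a \<ge> r ^ (epochs + j) then 1 else 0)) / of_nat s :: ennreal)"
  have r1: "r > 1" using r by simp
  have "of_nat (N - epochs) = (\<Sum>j<N - epochs. (1::ennreal))" by simp
  also have "\<dots> \<le> (\<Sum>j<N - epochs. g j)"
  proof (intro sum_mono)
    fix j assume "j \<in> {..<N - epochs}"
    then have "epochs + j < N" by auto
    then have "r ^ (epochs + j) \<le> thr T n" unfolding N_def by (intro less_levels_below r1)
    then have "s \<le> keys_above T n (r ^ (epochs + j))" using thr_ge_iff[OF pos] r1 by auto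
    also have "\<dots> \<le> card {a\<in>{..<n}. key T a \<ge> r ^ (epochs + j)}"
      unfolding keys_above_def by (intro card_mono) (auto dest: released_less)
    finally have "(of_nat s :: ennreal) \<le> of_nat (card {a\<in>{..<n}. key T a \<ge> r ^ (epochs + j)})" by simp
    also have "\<dots> = (\<Sum>a<n. (if key T a \<ge> r ^ (epochs + j) then 1 else 0))"
      by (subst sum.inter_filter[symmetric]) simp_all
    finally have "of_nat s / of_nat s \<le> g j" unfolding g_def by (rule divide_right_mono_ennreal)
    moreover have "(of_nat s :: ennreal) / of_nat s = 1" using s by (intro ennreal_divide_self) (auto intro: of_nat_less_top)
    ultimately show "1 \<le> g j" by simp
  qed
  also have "\<dots> \<le> (\<Sum>j. g j)" by (intro sum_le_suminf) auto
  finally have "of_nat (N - epochs) \<le> (\<Sum>j. g j)" .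
  then have "of_nat epochs + of_nat (N - epochs) \<le> level_bound T"
    unfolding level_bound_def g_def by (rule add_left_mono)
  moreover have "(of_nat N :: ennreal) \<le> of_nat epochs + of_nat (N - epochs)"
    by (subst of_nat_add[symmetric]) (simp only: of_nat_le_iff)
  ultimately show ?thesis unfolding N_def by (rule order_trans[rotated])
qed

lemma msgs_le:
  assumes pos: "\<And>i. i < n \<Longrightarrow> T i > 0"
  shows "of_nat (msgs (run k s w site T n))
    \<le> of_nat (card (early n) + k * card {j. full n j}) + (\<Sum>i\<in>regular n. reg_bound T i) + of_nat k * level_bound T"
proof -
  have "msgs (state T n) \<le> (card (early n) + k * card {j. full n j}) + card (sent T n) + k * levels_below r (thr T n)"
    using run_inv_state[of n T] pos by (simp add: run_inv_def thr_def)
  then have "(of_nat (msgs (state T n)) :: ennreal)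
    \<le> of_nat ((card (early n) + k * card {j. full n j}) + card (sent T n) + k * levels_below r (thr T n))"
    by (simp only: of_nat_le_iff)
  also have "\<dots> = of_nat (card (early n) + k * card {j. full n j}) + of_nat (card (sent T n)) + of_nat k * of_nat (levels_below r (thr T n))"
    by (simp only: of_nat_add of_nat_mult)
  also have "\<dots> \<le> of_nat (card (early n) + k * card {j. full n j}) + (\<Sum>i\<in>regular n. reg_bound T i) + of_nat k * level_bound T"
    by (intro add_mono mult_left_mono sent_le_reg_bound levels_le_level_bound pos order_refl) auto
  finally show ?thesis unfolding state_def .
qed

lemma key_ge_measurable [measurable]: "Measurable.pred (expM n) (\<lambda>T. c \<le> key T a)"
  unfolding pred_def by (intro borel_measurable_le key_measurable) auto

lemma nn_integral_key:
  assumes "a < n" "c > 0"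
  shows "(\<integral>\<^sup>+T. (if key T a \<ge> c then 1 else 0) \<partial>expM n) \<le> ennreal (w a / c)"
proof -
  interpret P: prob_space "expM n" by (rule prob_space_expM)
  have "(\<integral>\<^sup>+T. (if key T a \<ge> c then 1 else 0) \<partial>expM n) = (\<integral>\<^sup>+T. (if w a / T a \<ge> c then 1 else 0) * 1 \<partial>expM n)"
    by (simp add: key_def)
  also have "\<dots> = (\<integral>\<^sup>+t. (if w a / t \<ge> c then 1 else 0) \<partial>Exp1) * (\<integral>\<^sup>+T. 1 \<partial>expM n)"
    using assms(1) by (rule nn_integral_expM_indep) simp_all
  also have "\<dots> = (\<integral>\<^sup>+t. (if w a / t \<ge> c then 1 else 0) \<partial>Exp1)" by (simp add: P.emeasure_space_1)
  also have "\<dots> \<le> ennreal (w a / c)" using assms w_pos by (intro nn_integral_key_ge) auto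
  finally show ?thesis .
qed

text \<open>The set \<open>released i\<close> contains only indices below \<open>i\<close>, so the
  count of keys ignores the clock of \<open>i\<close> and the two indicators are
  independent.\<close>

lemma nn_integral_key_below:
  assumes "i < n" "c > 0"
  shows "(\<integral>\<^sup>+T. (if key T i \<ge> c then 1 else 0) * (if keys_above T i x < s then 1 else 0) \<partial>expM n)
    \<le> ennreal (w i / c) * below_prob i x"
proof -
  have upd: "keys_above (T(i := y)) i x = keys_above T i x" for T y
  proof -
    have "{a \<in> released i. x \<le> key (T(i := y)) a} = {a \<in> released i. x \<le> key T a}"
      by (auto simp: key_def released_def)
    then show ?thesis by (simp add: keys_above_def)
  qed
  have "(\<integral>\<^sup>+T. (if key T i \<ge> c then 1 else 0) * (if keys_above T i x < s then 1 else 0) \<partial>expM n)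
      = (\<integral>\<^sup>+t. (if w i / t \<ge> c then 1 else 0) \<partial>Exp1) * below_prob i x"
    unfolding below_prob_def key_def using assms(1)
    by (rule nn_integral_expM_indep) (simp_all add: upd)
  also have "\<dots> \<le> ennreal (w i / c) * below_prob i x"
    using assms w_pos by (intro mult_right_mono nn_integral_key_ge) auto
  finally show ?thesis .
qed

lemma W_nonneg: "W \<ge> 0" unfolding W_def using w_pos by (intro sum_nonneg) (simp add: less_imp_le)

lemma r_pow_epochs: "W \<le> real s * r ^ epochs"
proof (cases "W > 0")
  case True
  have r1: "r > 1" using r by simp
  have "log r (W / real s) \<le> real epochs" unfolding epochs_def by linarith
  then have "W / real s \<le> r powr real epochs" using True s r1 by (subst (asm) log_le_iff) auto
  then show ?thesis using s r1 by (simp add: powr_realpow field_simps)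
next
  case False
  then show ?thesis using r by (simp add: not_less order_trans[of W 0])
qed

lemma regular_less: "i \<in> regular n \<Longrightarrow> i < n" by (simp add: regular_def)

text \<open>Threshold \<open>0\<close> costs \<open>80 * s\<close>. Threshold \<open>r ^ j\<close>
  costs \<open>80 * s * r ^ Suc j / r ^ j = 80 * r * s\<close>, the factor \<open>r\<close> being
  the price of rounding. Keys of at least \<open>r ^ epochs\<close> cost at most
  \<open>W / r ^ epochs \<le> s\<close>.\<close>

lemma nn_integral_reg_bound:
  "(\<integral>\<^sup>+T. (\<Sum>i\<in>regular n. reg_bound T i) \<partial>expM n) \<le> ennreal (81 * real s + 80 * real epochs * r * real s)"
proof -
  have r0: "r ^ j > 0" for j using r by simp
  have one: "(\<integral>\<^sup>+T. reg_bound T i \<partial>expM n)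
      \<le> ennreal (w i) * below_prob i 1 + (\<Sum>j<epochs. ennreal (1 / r ^ j) * (ennreal (w i) * below_prob i (r ^ Suc j))) + ennreal (w i / r ^ epochs)"
    if i: "i \<in> regular n" for i
  proof -
    have "(\<integral>\<^sup>+T. reg_bound T i \<partial>expM n) = below_prob i 1
        + (\<Sum>j<epochs. \<integral>\<^sup>+T. (if key T i \<ge> r ^ j then 1 else 0) * (if keys_above T i (r ^ Suc j) < s then 1 else 0) \<partial>expM n)
        + (\<integral>\<^sup>+T. (if key T i \<ge> r ^ epochs then 1 else 0) \<partial>expM n)"
      unfolding reg_bound_def below_prob_def by (simp add: nn_integral_add nn_integral_sum)
    also have "\<dots> \<le> ennreal (w i) * below_prob i 1
        + (\<Sum>j<epochs. ennreal (1 / r ^ j) * (ennreal (w i) * below_prob i (r ^ Suc j))) + ennreal (w i / r ^ epochs)"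
    proof (intro add_mono sum_mono)
      \<comment> \<open>While the threshold is \<open>0\<close> the site does not filter, so the
        unit charge is replaced by the weight, which is at least \<open>1\<close>.\<close>
      have "1 * below_prob i 1 \<le> ennreal (w i) * below_prob i 1"
        using w[OF regular_less[OF i]] by (intro mult_right_mono) (simp_all flip: ennreal_1)
      then show "below_prob i 1 \<le> ennreal (w i) * below_prob i 1" by simp
      show "(\<integral>\<^sup>+T. (if key T i \<ge> r ^ epochs then 1 else 0) \<partial>expM n) \<le> ennreal (w i / r ^ epochs)"
        by (intro nn_integral_key regular_less i r0)
      fix j
      have "ennreal (w i / r ^ j) = ennreal (1 / r ^ j) * ennreal (w i)"
        using r0[of j] w_pos[OF regular_less[OF i]] by (subst ennreal_mult[symmetric]) auto
      then show "(\<integral>\<^sup>+T. (if key T i \<ge> r ^ j then 1 else 0) * (if keys_above T i (r ^ Suc j) < s then 1 else 0) \<partial>expM n)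
        \<le> ennreal (1 / r ^ j) * (ennreal (w i) * below_prob i (r ^ Suc j))"
        using nn_integral_key_below[OF regular_less[OF i] r0, of j "r ^ Suc j"] by (simp only: mult.assoc)
    qed
    finally show ?thesis .
  qed
  have meas: "(\<lambda>T. reg_bound T i) \<in> borel_measurable (expM n)" for i
    unfolding reg_bound_def by measurable
  have "(\<integral>\<^sup>+T. (\<Sum>i\<in>regular n. reg_bound T i) \<partial>expM n) = (\<Sum>i\<in>regular n. \<integral>\<^sup>+T. reg_bound T i \<partial>expM n)"
    using meas by (intro nn_integral_sum)
  also have "\<dots> \<le> (\<Sum>i\<in>regular n. ennreal (w i) * below_prob i 1
      + (\<Sum>j<epochs. ennreal (1 / r ^ j) * (ennreal (w i) * below_prob i (r ^ Suc j))) + ennreal (w i / r ^ epochs))"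
    by (intro sum_mono one)
  also have "\<dots> = (\<Sum>i\<in>regular n. ennreal (w i) * below_prob i 1)
      + (\<Sum>j<epochs. ennreal (1 / r ^ j) * (\<Sum>i\<in>regular n. ennreal (w i) * below_prob i (r ^ Suc j)))
      + (\<Sum>i\<in>regular n. ennreal (w i / r ^ epochs))"
    by (simp add: sum.distrib sum_distrib_left sum.swap[of _ _ "regular n"])
  also have "\<dots> \<le> ennreal (80 * real s * 1) + (\<Sum>j<epochs. ennreal (80 * r * real s)) + ennreal (real s)"
  proof (intro add_mono sum_mono sum_below_prob_le)
    fix j
    have "ennreal (1 / r ^ j) * (\<Sum>i\<in>regular n. ennreal (w i) * below_prob i (r ^ Suc j))
        \<le> ennreal (1 / r ^ j) * ennreal (80 * real s * r ^ Suc j)"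
      by (intro mult_left_mono sum_below_prob_le r0) auto
    also have "\<dots> = ennreal (1 / r ^ j * (80 * real s * r ^ Suc j))"
      using r0[of j] r by (subst ennreal_mult[symmetric]) auto
    also have "1 / r ^ j * (80 * real s * r ^ Suc j) = 80 * r * real s" using r0[of j] by simp
    finally show "ennreal (1 / r ^ j) * (\<Sum>i\<in>regular n. ennreal (w i) * below_prob i (r ^ Suc j)) \<le> ennreal (80 * r * real s)" .
  next
    have "(\<Sum>i\<in>regular n. ennreal (w i / r ^ epochs)) = ennreal (\<Sum>i\<in>regular n. w i / r ^ epochs)"
      using r0[of epochs] by (intro sum_ennreal) (auto intro!: divide_nonneg_pos less_imp_le[OF w_pos] regular_less)
    also have "\<dots> \<le> ennreal (real s)"
    proof (intro ennreal_leI)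
      have "(\<Sum>i\<in>regular n. w i) \<le> W" unfolding W_def
        by (intro sum_mono2) (auto dest: regular_less intro: less_imp_le[OF w_pos])
      then have "(\<Sum>i\<in>regular n. w i) \<le> real s * r ^ epochs" using r_pow_epochs by linarith
      then show "(\<Sum>i\<in>regular n. w i / r ^ epochs) \<le> real s"
        using r0[of epochs] by (simp add: sum_divide_distrib[symmetric] pos_divide_le_eq)
    qed
    finally show "(\<Sum>i\<in>regular n. ennreal (w i / r ^ epochs)) \<le> ennreal (real s)" .
  qed auto
  also have "(\<Sum>j<epochs. ennreal (80 * r * real s)) = ennreal (real epochs * (80 * r * real s))"
    using r by (simp add: ennreal_of_nat_eq_real_of_nat ennreal_mult)
  also have "ennreal (80 * real s * 1) + ennreal (real epochs * (80 * r * real s)) + ennreal (real s)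
      = ennreal (81 * real s + 80 * real epochs * r * real s)"
    using r by (simp add: ennreal_plus[symmetric] algebra_simps del: ennreal_plus)
  finally show ?thesis .
qed

text \<open>The choice of \<open>epochs\<close> gives \<open>W \<le> s * r ^ epochs\<close>, so the
  expected excess at distance \<open>j\<close> is at most \<open>1 / r ^ j\<close>. As
  \<open>r \<ge> 2\<close>, the geometric series sums to at most \<open>2\<close>.\<close>

lemma nn_integral_level_bound: "(\<integral>\<^sup>+T. level_bound T \<partial>expM n) \<le> ennreal (real epochs + 2)"
proof -
  interpret P: prob_space "expM n" by (rule prob_space_expM)
  define g where "g = (\<lambda>j T. (\<Sum>a<n. (if key T a \<ge> r ^ (epochs + j) then 1 else 0)) / of_nat s :: ennreal)"
  have [measurable]: "g j \<in> borel_measurable (expM n)" for j unfolding g_def by measurable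
  have lb: "level_bound T = of_nat epochs + (\<Sum>j. g j T)" for T by (simp add: level_bound_def g_def)
  have gj: "(\<integral>\<^sup>+T. g j T \<partial>expM n) \<le> ennreal ((1 / 2) ^ j)" for j
  proof -
    have r0: "r ^ i > 0" for i using r by simp
    have "(\<integral>\<^sup>+T. g j T \<partial>expM n) = (\<Sum>a<n. \<integral>\<^sup>+T. (if key T a \<ge> r ^ (epochs + j) then 1 else 0) \<partial>expM n) / of_nat s"
      unfolding g_def by (simp add: nn_integral_divide nn_integral_sum)
    also have "\<dots> \<le> (\<Sum>a<n. ennreal (w a / r ^ (epochs + j))) / of_nat s"
      using r0 by (intro divide_right_mono_ennreal sum_mono nn_integral_key) auto
    also have "(\<Sum>a<n. ennreal (w a / r ^ (epochs + j))) = ennreal (\<Sum>a<n. w a / r ^ (epochs + j))"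
      using r0 by (intro sum_ennreal) (auto intro!: divide_nonneg_pos less_imp_le[OF w_pos])
    also have "\<dots> / of_nat s = ennreal ((\<Sum>a<n. w a / r ^ (epochs + j)) / real s)"
      unfolding ennreal_of_nat_eq_real_of_nat using r0 s
      by (intro divide_ennreal sum_nonneg) (auto intro!: divide_nonneg_pos less_imp_le[OF w_pos])
    also have "\<dots> \<le> ennreal ((1 / 2) ^ j)"
    proof (intro ennreal_leI)
      have "(\<Sum>a<n. w a / r ^ (epochs + j)) / real s = W / (real s * r ^ epochs) / r ^ j"
        by (simp add: W_def sum_divide_distrib[symmetric] power_add mult_ac)
      also have "\<dots> \<le> 1 / r ^ j"
        using r_pow_epochs r0 s by (intro divide_right_mono) (auto simp: less_imp_le)
      also have "\<dots> \<le> 1 / 2 ^ j" using r by (intro divide_left_mono power_mono) auto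
      finally show "(\<Sum>a<n. w a / r ^ (epochs + j)) / real s \<le> (1 / 2) ^ j" by (simp add: power_divide)
    qed
    finally show ?thesis .
  qed
  have "(\<integral>\<^sup>+T. level_bound T \<partial>expM n) = of_nat epochs + (\<Sum>j. \<integral>\<^sup>+T. g j T \<partial>expM n)"
    unfolding lb
    by (simp add: nn_integral_add nn_integral_suminf P.emeasure_space_1)
  also have "\<dots> \<le> of_nat epochs + (\<Sum>j. ennreal ((1 / 2) ^ j))"
    by (intro add_left_mono suminf_le gj) auto
  also have "(\<Sum>j. ennreal ((1 / 2) ^ j)) = ennreal (\<Sum>j. (1 / 2 :: real) ^ j)"
    by (intro suminf_ennreal2) (auto simp: summable_geometric)
  also have "(\<Sum>j. (1 / 2 :: real) ^ j) = 2" by (subst suminf_geometric) auto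
  also have "of_nat epochs + ennreal 2 = ennreal (real epochs + 2)"
    by (subst ennreal_plus) (auto simp: ennreal_of_nat_eq_real_of_nat)
  finally show ?thesis .
qed

lemma nn_integral_msgs:
  "(\<integral>\<^sup>+T. ennreal (real (msgs (run k s w site T n))) \<partial>expM n)
    \<le> ennreal (real (card (early n)) + real k * real (card {j. full n j})
       + (81 * real s + 80 * real epochs * r * real s) + real k * (real epochs + 2))"
proof -
  interpret P: prob_space "expM n" by (rule prob_space_expM)
  let ?c = "card (early n) + k * card {j. full n j}"
  have [measurable]: "(\<lambda>T. reg_bound T i) \<in> borel_measurable (expM n)" for i
    unfolding reg_bound_def by measurable
  have [measurable]: "level_bound \<in> borel_measurable (expM n)"
    unfolding level_bound_def by measurable
  have "(\<integral>\<^sup>+T. ennreal (real (msgs (run k s w site T n))) \<partial>expM n)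
      \<le> (\<integral>\<^sup>+T. of_nat ?c + (\<Sum>i\<in>regular n. reg_bound T i) + of_nat k * level_bound T \<partial>expM n)"
  proof (rule nn_integral_mono_AE)
    show "AE T in expM n. ennreal (real (msgs (run k s w site T n)))
        \<le> of_nat ?c + (\<Sum>i\<in>regular n. reg_bound T i) + of_nat k * level_bound T"
      using AE_expM_pos
    proof eventually_elim
      case (elim T)
      then show ?case using msgs_le[of T] by (simp only: ennreal_of_nat_eq_real_of_nat)
    qed
  qed
  also have "\<dots> = of_nat ?c + (\<integral>\<^sup>+T. (\<Sum>i\<in>regular n. reg_bound T i) \<partial>expM n) + of_nat k * (\<integral>\<^sup>+T. level_bound T \<partial>expM n)"
    by (simp add: nn_integral_add nn_integral_cmult P.emeasure_space_1 del: of_nat_add of_nat_mult)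
  also have "\<dots> \<le> ennreal (real ?c) + ennreal (81 * real s + 80 * real epochs * r * real s) + ennreal (real k) * ennreal (real epochs + 2)"
    by (intro add_mono mult_mono nn_integral_reg_bound nn_integral_level_bound) (auto simp: ennreal_of_nat_eq_real_of_nat)
  also have "\<dots> = ennreal (real (card (early n)) + real k * real (card {j. full n j})
       + (81 * real s + 80 * real epochs * r * real s) + real k * (real epochs + 2))"
    using r by (simp add: ennreal_mult[symmetric] ennreal_plus[symmetric] del: ennreal_plus)
  finally show ?thesis .
qed

section \<open>Deterministic counts and the comparison with the target\<close>

lemma card_full_le: "card {j. full n j} \<le> epochs"
proof -
  have "{j. full n j} \<subseteq> {..<epochs}"
  proof
    fix j assume "j \<in> {j. full n j}"
    then have "4 * real s * r ^ Suc j \<le> released_weight n" using full_released_weight[of n j] by simp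
    also have "\<dots> \<le> W" unfolding released_weight_def W_def
      by (intro sum_mono2) (auto intro!: less_imp_le[OF w_pos] dest: released_less)
    also have "\<dots> \<le> real s * r ^ epochs" by (rule r_pow_epochs)
    \<comment> \<open>A full level forces the released weight to exceed its upper end
      \<open>4 * s\<close> times, so its index stays below \<open>epochs\<close>.\<close>
    finally have le: "4 * r ^ Suc j \<le> r ^ epochs" using s by simp
    show "j \<in> {..<epochs}"
    proof (rule ccontr)
      assume "j \<notin> {..<epochs}"
      then have "r ^ epochs \<le> r ^ Suc j" using r by (intro power_increasing) auto
      moreover have "r ^ Suc j > 0" using r by (intro zero_less_power) auto
      ultimately show False using le by linarith
    qed
  qed
  then show ?thesis using card_mono[of "{..<epochs}" "{j. full n j}"] by simp
qed

text \<open>Each level below \<open>epochs\<close> receives early items only until its buffer fills;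
  the \<open>+ 1\<close> is for the last early item, which arrives before saturation. Items of
  higher levels weigh at least \<open>r ^ epochs\<close> each, so at most \<open>s\<close> of them
  fit into \<open>W\<close>.\<close>

lemma card_early_le: "real (card (early n)) \<le> real epochs * (4 * r * real s + 1) + real s"
proof -
  define E where "E = (\<lambda>j. {i\<in>early n. lev i = j})"
  define H where "H = {i\<in>early n. lev i \<ge> epochs}"
  have fE: "finite (E j)" for j by (simp add: E_def)
  have Ej: "real (card (E j)) \<le> 4 * r * real s + 1" for j
  proof (cases "E j = {}")
    case True
    then show ?thesis using capacity_pos by simp
  next
    case False
    define i where "i = Max (E j)"
    have i: "i \<in> E j" unfolding i_def using False fE by (intro Max_in) auto
    have "E j \<subseteq> insert i (lev_items i j)"
    proof
      fix a assume a: "a \<in> E j"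
      then have "a \<le> i" unfolding i_def using fE by (intro Max_ge) auto
      then show "a \<in> insert i (lev_items i j)" using a by (auto simp: E_def lev_items_def)
    qed
    then have "card (E j) \<le> card (insert i (lev_items i j))" by (intro card_mono) auto
    also have "\<dots> \<le> card (lev_items i j) + 1" by (simp add: card_insert_if)
    finally have "real (card (E j)) \<le> real (card (lev_items i j)) + 1" by simp
    moreover have "\<not> full i j" using i by (auto simp: E_def early_def)
    ultimately show ?thesis by (simp add: full_def)
  qed
  have "real (card H) * r ^ epochs = (\<Sum>i\<in>H. r ^ epochs)" by simp
  also have "\<dots> \<le> (\<Sum>i\<in>H. w i)"
  proof (intro sum_mono)
    fix i assume i: "i \<in> H"
    then have "r ^ epochs \<le> r ^ lev i" using r by (intro power_increasing) (auto simp: H_def)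
    also have "\<dots> \<le> w i" using i by (intro lev_bounds) (auto simp: H_def early_def)
    finally show "r ^ epochs \<le> w i" .
  qed
  also have "\<dots> \<le> W" unfolding W_def
    by (intro sum_mono2) (auto simp: H_def early_def intro!: less_imp_le[OF w_pos])
  also have "\<dots> \<le> real s * r ^ epochs" by (rule r_pow_epochs)
  finally have H: "real (card H) \<le> real s" using r by simp
  have "early n = (\<Union>j<epochs. E j) \<union> H" by (auto simp: E_def H_def)
  then have "card (early n) \<le> card (\<Union>j<epochs. E j) + card H" by (simp add: card_Un_le)
  also have "card (\<Union>j<epochs. E j) \<le> (\<Sum>j<epochs. card (E j))" by (intro card_UN_le) auto
  finally have "real (card (early n)) \<le> real ((\<Sum>j<epochs. card (E j)) + card H)" by (simp only: of_nat_le_iff)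
  also have "\<dots> = (\<Sum>j<epochs. real (card (E j))) + real (card H)" by simp
  also have "\<dots> \<le> (\<Sum>j<epochs. 4 * r * real s + 1) + real s" by (intro add_mono sum_mono Ej H)
  finally show ?thesis by simp
qed

text \<open>Put \<open>y = k / s\<close>. For \<open>y \<ge> 2\<close> we have \<open>r = y\<close>,
  and \<open>1 + y \<le> y^2\<close> makes the logarithms comparable. Otherwise
  \<open>r = 2\<close>, where \<open>ln (1 + y) \<le> y\<close> and \<open>ln 2 \<ge> 2 / 3\<close>
  yield the factor \<open>3\<close>.\<close>

lemma rate_le: "r * real s / ln r \<le> 3 * real k / ln (1 + real k / real s)"
proof -
  define y where "y = real k / real s"
  have y: "y > 0" "real k = y * real s" using k s by (auto simp: y_def)
  have ly: "ln (1 + y) > 0" "ln r > 0" using y r by auto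
  have "r * ln (1 + y) \<le> 3 * y * ln r"
  proof (cases "y \<ge> 2")
    case True
    then have ry: "r = y" by (simp add: r_def rpar_def y_def)
    have "2 * y \<le> y * y" using True by (intro mult_right_mono) auto
    then have "1 + y \<le> y^2" using True unfolding power2_eq_square by linarith
    then have "ln (1 + y) \<le> ln (y^2)" using y by (subst ln_le_cancel_iff) auto
    then have "ln (1 + y) \<le> 2 * ln y" using y by (simp add: ln_realpow)
    then have "ln (1 + y) \<le> 3 * ln y" using ly(2) unfolding ry by linarith
    then have "y * ln (1 + y) \<le> y * (3 * ln y)" using y by (intro mult_left_mono) auto
    then show ?thesis by (simp add: ry)
  next
    case False
    then have r2: "r = 2" by (simp add: r_def rpar_def y_def)
    have "ln (1 + y) \<le> y" using y by (intro ln_add_one_self_le_self) auto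
    moreover have "2 * y \<le> 3 * y * ln 2" using ln2_ge_two_thirds y by simp
    ultimately show ?thesis by (simp add: r2)
  qed
  then have "r * ln (1 + y) * real s \<le> 3 * y * ln r * real s" by (rule mult_right_mono) simp
  then have "r * real s * ln (1 + y) \<le> 3 * real k * ln r" by (simp add: y(2) mult_ac)
  then show ?thesis using ly unfolding y_def[symmetric] by (simp add: frac_le_eq divide_le_eq pos_le_divide_eq mult_ac)
qed

text \<open>Put \<open>x = W / s\<close> and \<open>y = k / s\<close>. If \<open>x \<le> y\<close>,
  then \<open>ln (1 + y)\<close> exceeds \<open>ln (1 + x)\<close> by at most
  \<open>(y - x) / (1 + x)\<close>, and the factor \<open>x\<close> cancels that denominator. If
  \<open>x > y\<close>, then \<open>x < r\<close> forces \<open>r = 2\<close>, and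
  \<open>ln (1 + y) \<le> y\<close> suffices.\<close>

lemma few_items_bound:
  assumes "W < real s * r"
  shows "W \<le> 2 * real k * (1 + ln (1 + W / real s)) / ln (1 + real k / real s)"
proof -
  define y where "y = real k / real s"
  define x where "x = W / real s"
  have y: "y > 0" "real k = y * real s" using k s by (auto simp: y_def)
  have x: "x \<ge> 0" "W = x * real s" using W_nonneg s by (auto simp: x_def)
  have "x < r" using assms s x by (simp add: mult.commute)
  have ly: "ln (1 + y) > 0" "ln (1 + x) \<ge> 0" using y x by auto
  have "x * ln (1 + y) \<le> 2 * y * (1 + ln (1 + x))"
  proof (cases "x \<le> y")
    case True
    have "ln ((1 + y) / (1 + x)) \<le> (1 + y) / (1 + x) - 1" using x y by (intro ln_le_minus_one) auto
    then have "ln (1 + y) \<le> ln (1 + x) + (y - x) / (1 + x)" using x y by (simp add: ln_div field_simps)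
    then have "x * ln (1 + y) \<le> x * (ln (1 + x) + (y - x) / (1 + x))" using x by (intro mult_left_mono) auto
    also have "\<dots> = x * ln (1 + x) + x / (1 + x) * (y - x)" by (simp add: algebra_simps)
    also have "\<dots> \<le> y * ln (1 + x) + 1 * (y - 0)"
      using True x ly by (intro add_mono mult_mono) auto
    also have "\<dots> \<le> 2 * (y * (1 + ln (1 + x)))" using y ly by (simp add: algebra_simps)
    finally show ?thesis by simp
  next
    case False
    then have "x \<le> 2" using \<open>x < r\<close> by (auto simp: r_def rpar_def y_def split: if_splits)
    then have "x * ln (1 + y) \<le> 2 * y" using y ly x by (intro mult_mono ln_add_one_self_le_self) auto
    then show ?thesis using y ly by (simp add: algebra_simps add_increasing2)
  qed
  then have "x * ln (1 + y) * real s \<le> 2 * y * (1 + ln (1 + x)) * real s" by (rule mult_right_mono) simp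
  then have "W * ln (1 + y) \<le> 2 * real k * (1 + ln (1 + x))" by (simp add: x(2) y(2) mult_ac)
  then show ?thesis using ly unfolding y_def[symmetric] x_def[symmetric] by (simp add: pos_le_divide_eq)
qed

text \<open>The split is at \<open>W = s * r\<close>. Below it every message is an early one. Above
  it \<open>log r (W / s) \<ge> 1\<close>, so rounding up at most doubles the number of epochs, and
  all additive terms of order \<open>k\<close> and \<open>s\<close> are absorbed by
  \<open>epochs * r * s\<close>.\<close>

theorem expected_msgs:
  "(\<integral>\<^sup>+T. ennreal (real (msgs (run k s w site T n))) \<partial>expM n)
    \<le> ennreal (1026 * real k * (1 + ln (1 + W / real s)) / ln (1 + real k / real s))"
proof (cases "W < real s * r")
  case True
  have nf: "\<not> full n j" for j
  proof
    assume "full n j"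
    then have "4 * real s * r ^ Suc j \<le> released_weight n" using full_released_weight[of n j] by simp
    also have "\<dots> \<le> W" unfolding released_weight_def W_def
      by (intro sum_mono2) (auto intro!: less_imp_le[OF w_pos] dest: released_less)
    finally have "4 * real s * r ^ Suc j < real s * r" using True by simp
    then have "4 * r ^ j < 1" using s r by (simp add: mult_ac)
    moreover have "1 \<le> r ^ j" using r by (intro one_le_power) auto
    ultimately show False by simp
  qed
  have msgs: "msgs (run k s w site T n) \<le> n" if pos: "\<And>i. i < n \<Longrightarrow> T i > 0" for T
  proof -
    have inv: "run_inv T n (state T n)" using run_inv_state[of n T] pos by auto
    have "released n = {}" using nf by (auto simp: released_def)
    then have "coordS (state T n) = {}" using inv by (auto simp: run_inv_def sampler_inv_def top_set_def)
    then have "levels_below r (ukey s (key T) (coordS (state T n))) = 0" using s by (simp add: ukey_def levels_below_def)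
    moreover have "\<not> full i (lev i)" if "i < n" for i using nf[of "lev i"] full_mono[of i "lev i" n] that by auto
    then have "sent T n = {}" by (auto simp: sent_def)
    moreover have "card (early n) \<le> card {..<n}" by (intro card_mono) (auto simp: early_def)
    ultimately show ?thesis using inv nf by (simp add: run_inv_def state_def)
  qed
  have "real n = (\<Sum>i<n. 1)" by simp
  also have "\<dots> \<le> W" unfolding W_def using w by (intro sum_mono) auto
  also have "\<dots> \<le> 2 * real k * (1 + ln (1 + W / real s)) / ln (1 + real k / real s)"
    by (rule few_items_bound[OF True])
  also have "\<dots> \<le> 1026 * real k * (1 + ln (1 + W / real s)) / ln (1 + real k / real s)"
    using W_nonneg by (intro divide_right_mono mult_right_mono) auto
  finally have le: "real n \<le> 1026 * real k * (1 + ln (1 + W / real s)) / ln (1 + real k / real s)" .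
  interpret P: prob_space "expM n" by (rule prob_space_expM)
  have "(\<integral>\<^sup>+T. ennreal (real (msgs (run k s w site T n))) \<partial>expM n) \<le> (\<integral>\<^sup>+T. ennreal (real n) \<partial>expM n)"
  proof (rule nn_integral_mono_AE)
    show "AE T in expM n. ennreal (real (msgs (run k s w site T n))) \<le> ennreal (real n)"
      using AE_expM_pos by eventually_elim (intro ennreal_leI, use msgs in auto)
  qed
  also have "\<dots> = ennreal (real n)" by (simp add: P.emeasure_space_1)
  finally show ?thesis using le by (meson ennreal_leI order_trans)
next
  case False
  define x where "x = W / real s"
  define Z where "Z = r * real s"
  define m where "m = real epochs"
  have r1: "r > 1" using r by simp
  have xr: "x \<ge> r" using False s by (simp add: x_def pos_le_divide_eq mult.commute)
  have log1: "log r x \<ge> 1" using xr r1 by simp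
  have m: "m \<le> 2 * log r x" "m \<ge> 1"
  proof -
    have "m \<le> log r x + 1" using log1 unfolding m_def epochs_def x_def[symmetric] by linarith
    then show "m \<le> 2 * log r x" using log1 by simp
    show "m \<ge> 1" using log1 unfolding m_def epochs_def x_def[symmetric] by linarith
  qed
  have Z: "real k \<le> Z" "real s \<le> Z" "1 \<le> Z" "0 < Z"
  proof -
    have "real k / real s \<le> r" by (simp add: r_def rpar_def)
    then show "real k \<le> Z" using s by (simp add: Z_def pos_divide_le_eq)
    have "1 * real s \<le> r * real s" using r1 by (intro mult_right_mono) auto
    then show 1: "real s \<le> Z" by (simp add: Z_def)
    then show "1 \<le> Z" "0 < Z" using s by linarith+
  qed
  have mZ: "Z \<le> m * Z" using m Z by simp
  have kf: "real k * real (card {j. full n j}) \<le> Z * m"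
    using Z card_full_le by (intro mult_mono) (auto simp: m_def)
  have km: "real k * (m + 2) \<le> Z * (m + 2)" using Z m by (intro mult_right_mono) auto
  have "real (card (early n)) + real k * real (card {j. full n j})
       + (81 * real s + 80 * real epochs * r * real s) + real k * (real epochs + 2) \<le> 171 * (m * Z)"
  proof -
    have e: "real (card (early n)) \<le> m * (4 * Z + 1) + Z"
      using card_early_le Z(2) unfolding m_def Z_def mult.assoc by linarith
    have "m * (4 * Z + 1) \<le> m * (5 * Z)" using Z m by (intro mult_left_mono) auto
    then have 1: "real (card (early n)) \<le> 5 * (m * Z) + Z" using e by simp
    have 2: "real k * real (card {j. full n j}) \<le> m * Z" using kf by (simp add: mult.commute)
    have 3: "81 * real s + 80 * real epochs * r * real s \<le> 81 * Z + 80 * (m * Z)"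
      using Z(2) by (simp add: m_def Z_def)
    have 4: "real k * (real epochs + 2) \<le> m * Z + 2 * Z"
      using km by (simp add: m_def algebra_simps)
    have "real (card (early n)) + real k * real (card {j. full n j})
       + (81 * real s + 80 * real epochs * r * real s) + real k * (real epochs + 2)
       \<le> 5 * (m * Z) + Z + m * Z + (81 * Z + 80 * (m * Z)) + (m * Z + 2 * Z)"
      by (intro add_mono 1 2 3 4)
    also have "\<dots> = 87 * (m * Z) + 84 * Z" by simp
    also have "\<dots> \<le> 87 * (m * Z) + 84 * (m * Z)" using mZ by (intro add_left_mono mult_left_mono) simp_all
    also have "\<dots> = 171 * (m * Z)" by simp
    finally show ?thesis .
  qed
  \<comment> \<open>The constant is \<open>1026 = 171 * 2 * 3\<close>: \<open>2\<close> from
    rounding up the number of epochs and \<open>3\<close> from \<open>rate_le\<close>.\<close>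
  also have "171 * (m * Z) \<le> 171 * (2 * log r x * Z)" using m Z by (intro mult_left_mono mult_right_mono) auto
  also have "\<dots> = 342 * ln x * (Z / ln r)" by (simp add: log_def)
  also have "\<dots> \<le> 342 * (1 + ln (1 + x)) * (3 * real k / ln (1 + real k / real s))"
  proof (rule mult_mono)
    have "ln x \<le> ln (1 + x)" using xr r1 by (subst ln_le_cancel_iff) auto
    then show "342 * ln x \<le> 342 * (1 + ln (1 + x))" by simp
    show "Z / ln r \<le> 3 * real k / ln (1 + real k / real s)" using rate_le by (simp add: Z_def)
    show "0 \<le> 342 * (1 + ln (1 + x))" using xr r1 by simp
    show "0 \<le> Z / ln r" using Z r1 by simp
  qed
  also have "\<dots> = 1026 * real k * (1 + ln (1 + x)) / ln (1 + real k / real s)" by simp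
  finally have "real (card (early n)) + real k * real (card {j. full n j})
       + (81 * real s + 80 * real epochs * r * real s) + real k * (real epochs + 2)
       \<le> 1026 * real k * (1 + ln (1 + x)) / ln (1 + real k / real s)" .
  then show ?thesis unfolding x_def by (rule order_trans[OF nn_integral_msgs ennreal_leI])
qed

end

theorem theorem3p8:
  shows "(\<forall>(k::nat) (s::nat) (n::nat) (w::nat \<Rightarrow> real) (site::nat \<Rightarrow> nat).
            k \<ge> 1 \<and> s \<ge> 1 \<and> (\<forall>i<n. w i \<ge> 1 \<and> site i < k) \<longrightarrow>
            (\<forall>t\<in>{1..n}. \<forall>A.
               measure (expM n) {T \<in> space (expM n). query s w T t (run k s w site T t) = A}
               = pmf (swor w {..<t} (min t s)) A))
       \<and> (\<exists>C>0. \<forall>(k::nat) (s::nat) (n::nat) (w::nat \<Rightarrow> real) (site::nat \<Rightarrow> nat).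
            k \<ge> 1 \<and> s \<ge> 1 \<and> (\<forall>i<n. w i \<ge> 1 \<and> site i < k) \<longrightarrow>
            (\<integral>\<^sup>+ T. ennreal (real (msgs (run k s w site T n))) \<partial>expM n)
              \<le> ennreal (C * real k * (1 + ln (1 + (\<Sum>i<n. w i) / real s))
                            / ln (1 + real k / real s)))"
proof (intro conjI exI[of _ 1026] allI impI ballI)
  fix k s n t :: nat and w :: "nat \<Rightarrow> real" and site :: "nat \<Rightarrow> nat" and A
  assume "k \<ge> 1 \<and> s \<ge> 1 \<and> (\<forall>i<n. w i \<ge> 1 \<and> site i < k)"
  then interpret sampling_run k s n w site by unfold_locales auto
  assume "t \<in> {1..n}"
  then show "measure (expM n) {T \<in> space (expM n). query s w T t (run k s w site T t) = A}
    = pmf (swor w {..<t} (min t s)) A"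
    by (intro query_distribution) auto
next
  fix k s n :: nat and w :: "nat \<Rightarrow> real" and site :: "nat \<Rightarrow> nat"
  assume "k \<ge> 1 \<and> s \<ge> 1 \<and> (\<forall>i<n. w i \<ge> 1 \<and> site i < k)"
  then interpret sampling_run k s n w site by unfold_locales auto
  show "(\<integral>\<^sup>+ T. ennreal (real (msgs (run k s w site T n))) \<partial>expM n)
      \<le> ennreal (1026 * real k * (1 + ln (1 + (\<Sum>i<n. w i) / real s)) / ln (1 + real k / real s))"
    using expected_msgs unfolding W_def .
qed simp

end
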